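(* Let $A$ be a finite alphabet, let $f : A^{\mathbb{Z}} \to A^{\mathbb{Z}}$ be a cellular automaton, and suppose that the restriction of $f$ to its generic limit set $\tilde\omega(f)$ is equicontinuous. Then the language $\mathcal{L}(\tilde\omega(f))$ is $\Sigma^0_1$.
   Context: $\mathbb{N}$ contains $0$. For a finite alphabet $A$, the full shift $A^{\mathbb{Z}}$ has the metric $d(x,y) = \inf\{2^{-n} \mid x_{[-n,n]} = y_{[-n,n]}\}$ (inducing the product topology), and the left shift $\sigma$ is given by $\sigma(x)_i = x_{i+1}$. A cellular automaton (CA) on $A^{\mathbb{Z}}$ is a continuous map $f : A^{\mathbb{Z}} \to A^{\mathbb{Z}}$ commuting with $\sigma$. A subset of a topological space is comeager if it contains an intersection of countably many dense open sets. For $x \in A^{\mathbb{Z}}$, $\omega(x)$ is the set of limit points (limits of subsequences) of the forward orbit $(f^t(x))_{t\in\mathbb{N}}$. For $Y \subset A^{\mathbb{Z}}$, the realm of attraction is $\mathfrak{D}(Y) = \{x \in A^{\mathbb{Z}} \mid \omega(x) \subset Y\}$. The generic limit set $\tilde\omega(f)$ is the intersection of all closed sets $C \subset A^{\mathbb{Z}}$ such that $\mathfrak{D}(C)$ is comeager. It is a nonempty closed $\sigma$-invariant set, it is $f$-invariant, and it has a comeager realm. The restriction of $f$ to $X = \tilde\omega(f)$ is equicontinuous if the family of maps $(f^t|_X)_{t \in \mathbb{N}}$ is equicontinuous on $X$ with respect to $d$. For $w \in A^*$, $[w] = \{x \in A^{\mathbb{Z}} \mid x_{[0,|w|)} = w\}$.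 The language of $X$ is $\mathcal{L}(X) = \{w \in A^* \mid [w] \cap X \neq \emptyset\}$. $\Sigma^0_1$ means computably enumerable (as a subset of $A^*$). *)

theory Defs
  imports "HOL-Analysis.Analysis" "HOL-Library.Nat_Bijection"
begin

section \<open>The full shift and cellular automata\<close>

definition full_shift :: "(int \<Rightarrow> 'a) topology" where
  "full_shift = product_topology (\<lambda>_. discrete_topology UNIV) UNIV"

definition shift :: "(int \<Rightarrow> 'a) \<Rightarrow> (int \<Rightarrow> 'a)" where
  "shift x = (\<lambda>i. x (i + 1))"

definition cellular_automaton :: "((int \<Rightarrow> 'a) \<Rightarrow> (int \<Rightarrow> 'a)) \<Rightarrow> bool" where
  "cellular_automaton f \<longleftrightarrow>
     continuous_map full_shift full_shift f \<and> (\<forall>x. f (shift x) = shift (f x))"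

text \<open>The infimum is taken in the interval from 0 to 1, so that configurations that differ at the
  origin, for which no radius is admissible, have distance 1.\<close>

definition shift_dist :: "(int \<Rightarrow> 'a) \<Rightarrow> (int \<Rightarrow> 'a) \<Rightarrow> real" where
  "shift_dist x y =
     Inf (insert 1 {(1 / 2) ^ n | n. \<forall>i\<in>{- int n..int n}. x i = y i})"

lemma shift_dist_lessD:
  assumes "shift_dist x y < c"
  shows "c > 1 \<or> (\<exists>n. (1 / 2) ^ n < c \<and> (\<forall>i\<in>{- int n..int n}. x i = y i))"
  using cInf_lessD[OF _ assms[unfolded shift_dist_def]] by auto

lemma bdd_below_shift_dist:
  "bdd_below (insert (1::real) {(1 / 2) ^ n | n. \<forall>i\<in>{- int n..int n}. x i = y i})"
  by (rule bdd_belowI[of _ 0]) auto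

lemma shift_dist_le_1: "shift_dist x y \<le> 1"
  unfolding shift_dist_def by (rule cInf_lower[OF _ bdd_below_shift_dist]) simp

lemma shift_dist_le:
  assumes "\<And>i. i \<in> {- int n..int n} \<Longrightarrow> x i = y i"
  shows "shift_dist x y \<le> (1 / 2) ^ n"
  unfolding shift_dist_def by (rule cInf_lower[OF _ bdd_below_shift_dist]) (use assms in auto)

lemma shift_dist_nonneg: "0 \<le> shift_dist x y"
  unfolding shift_dist_def by (rule cInf_greatest) auto

lemma shift_dist_less_agree:
  assumes "shift_dist x y < (1 / 2) ^ n" "i \<in> {- int n..int n}"
  shows "x i = y i"
proof -
  have "(1 / 2 :: real) ^ n \<le> 1" by (simp add: power_le_one)
  then obtain m where m: "(1 / 2 :: real) ^ m < (1 / 2) ^ n" "\<forall>i\<in>{- int m..int m}. x i = y i"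
    using shift_dist_lessD[OF assms(1)] by auto
  from m(1) have "n < m" by (subst (asm) power_strict_decreasing_iff) auto
  with m(2) assms(2) show ?thesis by auto
qed

lemma shift_dist_triangle: "shift_dist x z \<le> max (shift_dist x y) (shift_dist y z)"
proof (rule dense_ge)
  fix c assume c: "max (shift_dist x y) (shift_dist y z) < c"
  show "shift_dist x z \<le> c"
  proof (cases "c > 1")
    case True
    then show ?thesis using shift_dist_le_1[of x z] by linarith
  next
    case False
    with c obtain n m where n: "(1 / 2) ^ n < c" "\<forall>i\<in>{- int n..int n}. x i = y i"
      and m: "(1 / 2) ^ m < c" "\<forall>i\<in>{- int m..int m}. y i = z i"
      using shift_dist_lessD[of x y c] shift_dist_lessD[of y z c] by auto
    have "shift_dist x z \<le> (1 / 2) ^ min n m"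
    proof (rule shift_dist_le)
      fix i assume "i \<in> {- int (min n m)..int (min n m)}"
      then have "i \<in> {- int n..int n}" "i \<in> {- int m..int m}" by auto
      with n(2) m(2) show "x i = z i" by simp
    qed
    also have "\<dots> < c" using n m by (simp add: min_def)
    finally show ?thesis by simp
  qed
qed

interpretation shift_metric: Metric_space UNIV shift_dist
proof
  fix x y z :: "int \<Rightarrow> 'a"
  show "0 \<le> shift_dist x y" by (rule shift_dist_nonneg)
  show "shift_dist x y = shift_dist y x" unfolding shift_dist_def by (simp add: eq_commute)
  show "shift_dist x z \<le> shift_dist x y + shift_dist y z"
    using shift_dist_triangle[of x z y] shift_dist_nonneg[of x y] shift_dist_nonneg[of y z]
    by linarith
  show "(shift_dist x y = 0) = (x = y)"
  proof
    assume 0: "shift_dist x y = 0"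
    show "x = y"
    proof
      fix i show "x i = y i"
        by (rule shift_dist_less_agree[where n = "nat \<bar>i\<bar>"]) (auto simp: 0)
    qed
  next
    assume "x = y"
    then have *: "shift_dist x y \<le> (1 / 2) ^ n" for n by (intro shift_dist_le) auto
    have "shift_dist x y \<le> 0"
    proof (rule LIMSEQ_le_const)
      show "(\<lambda>n. (1 / 2 :: real) ^ n) \<longlonglongrightarrow> 0" by (simp add: LIMSEQ_realpow_zero)
    qed (use * in auto)
    with shift_dist_nonneg[of x y] show "shift_dist x y = 0" by simp
  qed
qed

lemma mtopology_shift_dist: "shift_metric.mtopology = full_shift"
proof (rule topology_eq[THEN iffD2], rule allI)
  fix S :: "(int \<Rightarrow> 'a) set"
  show "openin shift_metric.mtopology S = openin full_shift S"
  proof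
    assume S: "openin shift_metric.mtopology S"
    show "openin full_shift S"
      unfolding full_shift_def openin_product_topology_alt
    proof
      fix x assume "x \<in> S"
      with S obtain r where r: "r > 0" "shift_metric.mball x r \<subseteq> S"
        unfolding shift_metric.openin_mtopology by blast
      obtain n where n: "(1 / 2 :: real) ^ n < r"
        using real_arch_pow_inv[OF r(1), of "1 / 2"] by auto
      define U where "U = (\<lambda>i. if i \<in> {- int n..int n} then {x i} else UNIV)"
      have "Pi\<^sub>E UNIV U \<subseteq> S"
      proof
        fix y assume "y \<in> Pi\<^sub>E UNIV U"
        then have "\<And>i. y i \<in> U i" by (auto simp: PiE_iff)
        then have "\<And>i. i \<in> {- int n..int n} \<Longrightarrow> x i = y i"
          unfolding U_def by (metis singletonD)
        then have "shift_dist x y < r" using shift_dist_le[of n x y] n by fastforce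
        with r show "y \<in> S" by (auto simp: shift_metric.in_mball)
      qed
      moreover have "finite {i \<in> UNIV. U i \<noteq> topspace (discrete_topology UNIV)}"
        by (rule finite_subset[of _ "{- int n..int n}"]) (auto simp: U_def)
      moreover have "x \<in> Pi\<^sub>E UNIV U" by (auto simp: U_def)
      ultimately show "\<exists>U. finite {i \<in> UNIV. U i \<noteq> topspace (discrete_topology UNIV)} \<and>
          (\<forall>i\<in>UNIV. openin (discrete_topology UNIV) (U i)) \<and> x \<in> Pi\<^sub>E UNIV U \<and> Pi\<^sub>E UNIV U \<subseteq> S"
        by auto
    qed
  next
    assume S: "openin full_shift S"
    show "openin shift_metric.mtopology S"
      unfolding shift_metric.openin_mtopology
    proof (intro conjI allI impI)
      fix x assume "x \<in> S"
      with S obtain U where U: "finite {i. U i \<noteq> UNIV}" "x \<in> Pi\<^sub>E UNIV U" "Pi\<^sub>E UNIV U \<subseteq> S"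
        unfolding full_shift_def openin_product_topology_alt by auto
      obtain n where n: "\<And>i. U i \<noteq> UNIV \<Longrightarrow> i \<in> {- int n..int n}"
      proof -
        have "finite ((\<lambda>i. nat \<bar>i\<bar>) ` {i. U i \<noteq> UNIV})" using U(1) by simp
        then obtain n where "\<forall>k\<in>(\<lambda>i. nat \<bar>i\<bar>) ` {i. U i \<noteq> UNIV}. k \<le> n"
          using finite_nat_set_iff_bounded_le by blast
        then have "\<And>i. U i \<noteq> UNIV \<Longrightarrow> i \<in> {- int n..int n}" by fastforce
        then show thesis by (rule that)
      qed
      have "shift_metric.mball x ((1 / 2) ^ n) \<subseteq> S"
      proof
        fix y assume "y \<in> shift_metric.mball x ((1 / 2) ^ n)"
        then have "\<And>i. i \<in> {- int n..int n} \<Longrightarrow> x i = y i"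
          by (auto intro: shift_dist_less_agree simp: shift_metric.in_mball)
        then have "y i \<in> U i" for i
          using n[of i] U(2) by (metis PiE_mem UNIV_I)
        then show "y \<in> S" using U(3) by auto
      qed
      then show "\<exists>r>0. shift_metric.mball x r \<subseteq> S" by (intro exI[of _ "(1 / 2) ^ n"]) auto
    qed auto
  qed
qed

section \<open>The generic limit set\<close>

definition comeager_in :: "'b topology \<Rightarrow> 'b set \<Rightarrow> bool" where
  "comeager_in X S \<longleftrightarrow>
     (\<exists>\<U>. countable \<U> \<and> (\<forall>U\<in>\<U>. openin X U \<and> X closure_of U = topspace X) \<and>
          topspace X \<inter> \<Inter>\<U> \<subseteq> S)"

definition omega_limit :: "((int \<Rightarrow> 'a) \<Rightarrow> (int \<Rightarrow> 'a)) \<Rightarrow> (int \<Rightarrow> 'a) \<Rightarrow> (int \<Rightarrow> 'a) set" where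
  "omega_limit f x =
     {y. \<exists>r::nat \<Rightarrow> nat. strict_mono r \<and> limitin full_shift (\<lambda>n. (f ^^ r n) x) y sequentially}"

definition realm :: "((int \<Rightarrow> 'a) \<Rightarrow> (int \<Rightarrow> 'a)) \<Rightarrow> (int \<Rightarrow> 'a) set \<Rightarrow> (int \<Rightarrow> 'a) set" where
  "realm f Y = {x. omega_limit f x \<subseteq> Y}"

definition generic_limit_set :: "((int \<Rightarrow> 'a) \<Rightarrow> (int \<Rightarrow> 'a)) \<Rightarrow> (int \<Rightarrow> 'a) set" where
  "generic_limit_set f = \<Inter>{C. closedin full_shift C \<and> comeager_in full_shift (realm f C)}"

definition equicontinuous_restriction ::
    "((int \<Rightarrow> 'a) \<Rightarrow> (int \<Rightarrow> 'a)) \<Rightarrow> (int \<Rightarrow> 'a) set \<Rightarrow> bool" where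
  "equicontinuous_restriction f X \<longleftrightarrow>
     (\<forall>x\<in>X. \<forall>\<epsilon>>0. \<exists>\<delta>>0. \<forall>y\<in>X. shift_dist x y < \<delta> \<longrightarrow>
        (\<forall>t. shift_dist ((f ^^ t) x) ((f ^^ t) y) < \<epsilon>))"

section \<open>Languages\<close>

definition cylinder :: "'a list \<Rightarrow> (int \<Rightarrow> 'a) set" where
  "cylinder w = {x. \<forall>i<length w. x (int i) = w ! i}"

definition language :: "(int \<Rightarrow> 'a) set \<Rightarrow> 'a list set" where
  "language X = {w. cylinder w \<inter> X \<noteq> {}}"

section \<open>Computable enumerability\<close>

text \<open>Programs for the partial recursive functions. Arities are left implicit: a program may be
  applied to argument lists of any length, and its value is undefined where no rule applies.\<close>

datatype recf =
    Zero
  | Succ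
  | Proj nat
  | Comp recf "recf list"
  | PrimRec recf recf
  | Mu recf

inductive rec_eval :: "recf \<Rightarrow> nat list \<Rightarrow> nat \<Rightarrow> bool" where
  Zero: "rec_eval Zero xs 0"
| Succ: "rec_eval Succ [x] (Suc x)"
| Proj: "i < length xs \<Longrightarrow> rec_eval (Proj i) xs (xs ! i)"
| Comp: "list_all2 (\<lambda>g y. rec_eval g xs y) gs ys \<Longrightarrow> rec_eval h ys z \<Longrightarrow>
    rec_eval (Comp h gs) xs z"
| PrimRec_0: "rec_eval g xs y \<Longrightarrow> rec_eval (PrimRec g h) (0 # xs) y"
| PrimRec_Suc: "rec_eval (PrimRec g h) (n # xs) r \<Longrightarrow> rec_eval h (n # r # xs) y \<Longrightarrow>
    rec_eval (PrimRec g h) (Suc n # xs) y"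
| Mu: "rec_eval g (n # xs) 0 \<Longrightarrow> (\<And>m. m < n \<Longrightarrow> \<exists>k. rec_eval g (m # xs) (Suc k)) \<Longrightarrow>
    rec_eval (Mu g) xs n"

lemma rec_eval_deterministic: "rec_eval p xs y \<Longrightarrow> rec_eval p xs z \<Longrightarrow> y = z"
proof (induction p xs y arbitrary: z rule: rec_eval.induct)
  case (Zero xs)
  then show ?case by (cases rule: rec_eval.cases) auto
next
  case (Succ x)
  then show ?case by (cases rule: rec_eval.cases) auto
next
  case (Proj i xs)
  from Proj.prems show ?case by (cases rule: rec_eval.cases) auto
next
  case (Comp xs gs ys h w)
  from Comp.prems obtain ys' where ys': "list_all2 (\<lambda>g y. rec_eval g xs y) gs ys'"
    "rec_eval h ys' z" by (cases rule: rec_eval.cases) auto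
  have "ys = ys'"
    using Comp.IH(1) ys'(1) by (auto simp: list_all2_conv_all_nth intro!: nth_equalityI)
  with ys' Comp.IH(2) show ?case by blast
next
  case (PrimRec_0 g xs y h)
  from PrimRec_0.prems have "rec_eval g xs z" by (cases rule: rec_eval.cases) auto
  then show ?case by (rule PrimRec_0.IH)
next
  case (PrimRec_Suc g h n xs r y)
  from PrimRec_Suc.prems obtain r' where r':
    "rec_eval (PrimRec g h) (n # xs) r'" "rec_eval h (n # r' # xs) z"
    by (cases rule: rec_eval.cases) auto
  from PrimRec_Suc.IH(1)[OF r'(1)] r'(2) show ?case by (intro PrimRec_Suc.IH(2)) simp
next
  case (Mu g n xs)
  from Mu.prems have z: "rec_eval g (z # xs) 0"
    "\<And>m. m < z \<Longrightarrow> \<exists>k. rec_eval g (m # xs) (Suc k)"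
    by (cases rule: rec_eval.cases; auto)+
  show ?case
  proof (rule ccontr)
    assume "n \<noteq> z"
    then consider "n < z" | "z < n" by linarith
    then show False
    proof cases
      case 1
      with z(2) obtain k where "rec_eval g (n # xs) (Suc k)" by blast
      from Mu.IH(1)[OF this] show False by simp
    next
      case 2
      with Mu.IH(2) z(1) show False by blast
    qed
  qed
qed

text \<open>A set of numbers is computably enumerable iff it is the domain of a unary partial recursive
  function.\<close>

definition ce_set :: "nat set \<Rightarrow> bool" where
  "ce_set S \<longleftrightarrow> (\<exists>p. \<forall>x. x \<in> S \<longleftrightarrow> (\<exists>y. rec_eval p [x] y))"

text \<open>Words are encoded as numbers by numbering the letters and then applying the computable
  bijection \<^const>\<open>list_encode\<close> between lists of numbers and numbers. As the alphabet is finite,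
  the choice of the numbering is immaterial. (The encoding \<^const>\<open>to_nat\<close> of words
  would not do, as it is an arbitrary injection.)\<close>

definition ce_language :: "'a::finite list set \<Rightarrow> bool" where
  "ce_language L \<longleftrightarrow>
     (\<forall>e::'a \<Rightarrow> nat. bij_betw e UNIV {..<CARD('a)} \<longrightarrow> ce_set ((\<lambda>w. list_encode (map e w)) ` L))"

end

theory Submission
  imports Defs
begin

text \<open>
  Let \<open>X\<close> be the generic limit set. A word occurs in \<open>X\<close> iff the set of points that visit its
  cylinder infinitely often is not meager. Equicontinuity on \<open>X\<close> makes some \<open>f\<^sup>q\<close> and \<open>f\<^bsup>q + p\<^esup>\<close>
  agree near the origin on \<open>X\<close>; by Baire's theorem this spreads to a cylinder of the full shift, which gives a
  blocking word: its central column of width \<open>2 * R + 1\<close>, with \<open>R\<close> the radius of \<open>f\<close>, evolves independently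
  of the rest of the configuration. Between two blocking words the evolution is determined by the
  finite word in between. Hence \<open>w\<close> occurs in \<open>X\<close> iff it occurs in the temporal cycle of a spatially periodic
  configuration that contains the blocking word, and such a configuration, with its finite
  space-time diagram, is a certificate that can be checked mechanically.
\<close>

section \<open>Recursive functions\<close>

text \<open>Reading with default 0 makes terms total on lists of any length. Bound variables are
  pushed to the front, so parameters stay reachable through \<open>tl\<close>.\<close>

definition var :: "nat \<Rightarrow> nat list \<Rightarrow> nat" where
  "var i xs = (if i < length xs then xs ! i else 0)"

lemma var_tl [simp]: "var i (tl xs) = var (Suc i) xs"
  by (auto simp: var_def nth_tl)

lemma var_Cons [simp]: "var 0 (x # xs) = x" "var (Suc i) (x # xs) = var i xs"
  by (auto simp: var_def)

definition computable :: "nat \<Rightarrow> (nat list \<Rightarrow> nat) \<Rightarrow> bool" where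
  "computable n F \<longleftrightarrow> (\<exists>p. \<forall>xs. length xs = n \<longrightarrow> rec_eval p xs (F xs))"

text \<open>Truth is coded by 0: a conjunction becomes a sum, and a \<open>Mu\<close> search stops
  at the first witness.\<close>

definition decidable :: "nat \<Rightarrow> (nat list \<Rightarrow> bool) \<Rightarrow> bool" where
  "decidable n P \<longleftrightarrow> (\<exists>F. computable n F \<and> (\<forall>xs. length xs = n \<longrightarrow> P xs \<longleftrightarrow> F xs = 0))"

lemma computable_cong:
  assumes "computable n F" "\<And>xs. length xs = n \<Longrightarrow> F xs = G xs"
  shows "computable n G"
  using assms unfolding computable_def by metis

lemma computable_var: "i < n \<Longrightarrow> computable n (\<lambda>xs. var i xs)"
  unfolding computable_def var_def by (intro exI[of _ "Proj i"]) (auto intro: rec_eval.Proj)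

lemma computable_compose:
  assumes "computable (length gs) F" "\<And>g. g \<in> set gs \<Longrightarrow> computable n g"
  shows "computable n (\<lambda>xs. F (map (\<lambda>g. g xs) gs))"
proof -
  from assms(1) obtain p where p: "\<And>ys. length ys = length gs \<Longrightarrow> rec_eval p ys (F ys)"
    unfolding computable_def by blast
  have "\<forall>g. \<exists>q. g \<in> set gs \<longrightarrow> (\<forall>xs. length xs = n \<longrightarrow> rec_eval q xs (g xs))"
    using assms(2) unfolding computable_def by blast
  then obtain q where q: "\<And>g xs. g \<in> set gs \<Longrightarrow> length xs = n \<Longrightarrow> rec_eval (q g) xs (g xs)"
    by metis
  have "rec_eval (Comp p (map q gs)) xs (F (map (\<lambda>g. g xs) gs))" if "length xs = n" for xs
  proof (rule rec_eval.Comp)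
    show "list_all2 (\<lambda>g y. rec_eval g xs y) (map q gs) (map (\<lambda>g. g xs) gs)"
      using q that by (auto simp: list_all2_conv_all_nth)
  qed (simp add: p)
  then show ?thesis unfolding computable_def by blast
qed

lemma computable_Suc:
  assumes "computable n F"
  shows "computable n (\<lambda>xs. Suc (F xs))"
proof -
  have "computable (length [F]) (\<lambda>ys. Suc (var 0 ys))"
    unfolding computable_def
    by (intro exI[of _ Succ]) (auto simp: length_Suc_conv intro: rec_eval.Succ)
  from computable_compose[OF this] assms show ?thesis by simp
qed

lemma computable_const: "computable n (\<lambda>_. c)"
proof (induction c)
  case 0
  show ?case unfolding computable_def by (intro exI[of _ Zero]) (auto intro: rec_eval.Zero)
qed (rule computable_Suc)

text \<open>The argument order of \<open>H\<close> is that of \<open>PrimRec\<close>: counter,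
  previous value, parameters.\<close>

lemma computable_rec:
  assumes B: "computable n B" and G: "computable n G"
    and H: "computable (Suc (Suc n)) (\<lambda>ys. H (var 0 ys) (var 1 ys) (tl (tl ys)))"
  shows "computable n (\<lambda>xs. rec_nat (G xs) (\<lambda>i r. H i r xs) (B xs))"
proof -
  obtain g h where g: "\<And>xs. length xs = n \<Longrightarrow> rec_eval g xs (G xs)"
    and h: "\<And>ys. length ys = Suc (Suc n) \<Longrightarrow>
      rec_eval h ys (H (var 0 ys) (var 1 ys) (tl (tl ys)))"
    using G H unfolding computable_def by blast
  have step: "rec_eval (PrimRec g h) (i # xs) (rec_nat (G xs) (\<lambda>i r. H i r xs) i)"
    if xs: "length xs = n" for i xs
  proof (induction i)
    case 0
    show ?case using g[OF xs] by (auto intro: rec_eval.PrimRec_0)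
  next
    case (Suc i)
    show ?case
      using rec_eval.PrimRec_Suc[OF Suc] h[of "i # _ # xs"] xs by (auto simp: var_def)
  qed
  \<comment> \<open>The depth of recursion becomes the first argument; composing with
    \<open>B\<close> and all projections brings the parameters back.\<close>
  define F where "F = (\<lambda>ys. rec_nat (G (tl ys)) (\<lambda>i r. H i r (tl ys)) (var 0 ys))"
  let ?gs = "B # map var [0..<n]"
  have "computable (length ?gs) F"
    unfolding computable_def F_def
    by (intro exI[of _ "PrimRec g h"]) (auto simp: length_Suc_conv step)
  then have "computable n (\<lambda>xs. F (map (\<lambda>g. g xs) ?gs))"
    by (rule computable_compose) (auto simp: B intro: computable_var)
  then show ?thesis
  proof (rule computable_cong)
    fix xs :: "nat list" assume "length xs = n"
    then have "map (\<lambda>g. g xs) (map var [0..<n]) = xs"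
      by (auto intro!: nth_equalityI simp: var_def)
    then show "F (map (\<lambda>g. g xs) ?gs) = rec_nat (G xs) (\<lambda>i r. H i r xs) (B xs)"
      by (simp add: F_def)
  qed
qed

text \<open>Adapts a function of counter and parameters to a recursion step, where the previous
  value stands between them.\<close>

lemma computable_skip:
  assumes "computable (Suc n) (\<lambda>ys. G (var 0 ys) (tl ys))"
  shows "computable (Suc (Suc n)) (\<lambda>ys. G (var 0 ys) (tl (tl ys)))"
proof -
  let ?gs = "var 0 # map var [2..<Suc (Suc n)]"
  have "computable (Suc (Suc n)) (\<lambda>ys. G (var 0 (map (\<lambda>g. g ys) ?gs)) (tl (map (\<lambda>g. g ys) ?gs)))"
    by (rule computable_compose) (use assms in \<open>auto intro: computable_var simp del: upt_Suc\<close>)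
  then show ?thesis
  proof (rule computable_cong)
    fix ys :: "nat list" assume "length ys = Suc (Suc n)"
    then have "map (\<lambda>g. g ys) (map var [2..<Suc (Suc n)]) = tl (tl ys)"
      by (intro nth_equalityI) (auto simp: var_def nth_tl simp del: upt_Suc)
    then show "G (var 0 (map (\<lambda>g. g ys) ?gs)) (tl (map (\<lambda>g. g ys) ?gs)) = G (var 0 ys) (tl (tl ys))"
      by simp
  qed
qed

lemma computable_add:
  assumes "computable n F" "computable n G"
  shows "computable n (\<lambda>xs. F xs + G xs)"
proof -
  have "rec_nat b (\<lambda>_. Suc) a = a + b" for a b by (induction a) auto
  then show ?thesis
    using computable_rec[OF assms, of "\<lambda>i r xs. Suc r"] by (simp add: computable_Suc computable_var)
qed

lemma computable_bounded_sum:
  assumes "computable n B" "computable (Suc n) (\<lambda>ys. G (var 0 ys) (tl ys))"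
  shows "computable n (\<lambda>xs. \<Sum>i<B xs. G i xs)"
proof -
  have *: "rec_nat 0 (\<lambda>i r. r + g i) b = (\<Sum>i<b. g i)" for g :: "nat \<Rightarrow> nat" and b
    by (induction b) auto
  show ?thesis
    using computable_rec[OF assms(1) computable_const[of n 0], of "\<lambda>i r xs. r + G i xs"]
      computable_skip[OF assms(2)]
    by (simp add: * computable_add computable_var)
qed

lemma computable_weaken:
  assumes "computable n F"
  shows "computable (Suc n) (\<lambda>ys. F (tl ys))"
proof -
  have "computable (Suc n) (\<lambda>ys. F (map (\<lambda>g. g ys) (map var [1..<Suc n])))"
    by (rule computable_compose) (use assms in \<open>auto intro: computable_var simp del: upt_Suc\<close>)
  then show ?thesis
  proof (rule computable_cong)
    fix ys :: "nat list" assume "length ys = Suc n"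
    then have "map (\<lambda>g. g ys) (map var [1..<Suc n]) = tl ys"
      by (intro nth_equalityI) (auto simp: var_def nth_tl simp del: upt_Suc)
    then show "F (map (\<lambda>g. g ys) (map var [1..<Suc n])) = F (tl ys)" by simp
  qed
qed

lemma computable_mult:
  assumes "computable n F" "computable n G"
  shows "computable n (\<lambda>xs. F xs * G xs)"
  using computable_bounded_sum[OF assms(1), of "\<lambda>i xs. G xs"] computable_weaken[OF assms(2)] by simp

lemma computable_pred:
  assumes "computable n F"
  shows "computable n (\<lambda>xs. F xs - 1)"
proof -
  have "rec_nat 0 (\<lambda>i r. i) a = a - 1" for a by (cases a) auto
  then show ?thesis
    using computable_rec[OF assms computable_const[of n 0], of "\<lambda>i r xs. i"]
    by (simp add: computable_var)
qed

lemma computable_diff: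
  assumes "computable n F" "computable n G"
  shows "computable n (\<lambda>xs. F xs - G xs)"
proof -
  have "rec_nat a (\<lambda>i r. r - 1) b = a - b" for a b by (induction b) auto
  then show ?thesis
    using computable_rec[OF assms(2,1), of "\<lambda>i r xs. r - 1"] computable_pred[OF computable_var]
    by simp
qed

section \<open>Decidable predicates\<close>

lemma decidable_eq:
  assumes "computable n F" "computable n G"
  shows "decidable n (\<lambda>xs. F xs = G xs)"
  unfolding decidable_def
  \<comment> \<open>Subtraction is truncated, so both differences vanish exactly at
    equality.\<close>
  by (intro exI[of _ "\<lambda>xs. (F xs - G xs) + (G xs - F xs)"] conjI computable_add computable_diff assms)
     auto

lemma decidable_less:
  assumes "computable n F" "computable n G"
  shows "decidable n (\<lambda>xs. F xs < G xs)"
  unfolding decidable_def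
  by (intro exI[of _ "\<lambda>xs. Suc (F xs) - G xs"] conjI computable_Suc computable_diff assms) auto

lemma decidable_not:
  assumes "decidable n P"
  shows "decidable n (\<lambda>xs. \<not> P xs)"
proof -
  from assms obtain F where "computable n F" "\<And>xs. length xs = n \<Longrightarrow> P xs \<longleftrightarrow> F xs = 0"
    unfolding decidable_def by blast
  then show ?thesis
    unfolding decidable_def
    by (intro exI[of _ "\<lambda>xs. 1 - F xs"]) (auto intro: computable_const computable_diff)
qed

lemma decidable_conj:
  assumes "decidable n P" "decidable n Q"
  shows "decidable n (\<lambda>xs. P xs \<and> Q xs)"
proof -
  from assms obtain F G where "computable n F" "\<And>xs. length xs = n \<Longrightarrow> P xs \<longleftrightarrow> F xs = 0"
    "computable n G" "\<And>xs. length xs = n \<Longrightarrow> Q xs \<longleftrightarrow> G xs = 0"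
    unfolding decidable_def by blast
  then show ?thesis
    unfolding decidable_def by (intro exI[of _ "\<lambda>xs. F xs + G xs"]) (auto intro: computable_add)
qed

lemma decidable_disj:
  assumes "decidable n P" "decidable n Q"
  shows "decidable n (\<lambda>xs. P xs \<or> Q xs)"
  using decidable_not[OF decidable_conj[OF decidable_not[OF assms(1)] decidable_not[OF assms(2)]]]
  by simp

lemma decidable_imp:
  assumes "decidable n P" "decidable n Q"
  shows "decidable n (\<lambda>xs. P xs \<longrightarrow> Q xs)"
  unfolding imp_conv_disj by (intro decidable_disj decidable_not assms)

lemma decidable_bounded_all:
  assumes "computable n B" "decidable (Suc n) (\<lambda>ys. P (var 0 ys) (tl ys))"
  shows "decidable n (\<lambda>xs. \<forall>i<B xs. P i xs)"
proof -
  from assms(2) obtain F where F: "computable (Suc n) F"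
    "\<And>ys. length ys = Suc n \<Longrightarrow> P (var 0 ys) (tl ys) \<longleftrightarrow> F ys = 0"
    unfolding decidable_def by blast
  \<comment> \<open>Splitting the list into head and tail gives the shape expected by
    \<open>computable_bounded_sum\<close>; a sum of naturals vanishes iff every term does.\<close>
  have "computable (Suc n) (\<lambda>ys. F (var 0 ys # tl ys))"
    by (rule computable_cong[OF F(1)]) (auto simp: length_Suc_conv)
  then have "computable n (\<lambda>xs. \<Sum>i<B xs. F (i # xs))"
    by (intro computable_bounded_sum assms)
  moreover have "(\<forall>i<B xs. P i xs) \<longleftrightarrow> (\<Sum>i<B xs. F (i # xs)) = 0" if "length xs = n" for xs
    using F(2)[of "_ # xs"] that by auto
  ultimately show ?thesis unfolding decidable_def by blast
qed

text \<open>A witness exists for every list, so the \<open>Mu\<close> search always halts.\<close>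

lemma computable_Least:
  assumes "decidable (Suc n) (\<lambda>ys. P (var 0 ys) (tl ys))" "\<And>xs. \<exists>i. P i xs"
  shows "computable n (\<lambda>xs. LEAST i. P i xs)"
proof -
  from assms(1) obtain F p where F: "\<And>ys. length ys = Suc n \<Longrightarrow> rec_eval p ys (F ys)"
    "\<And>ys. length ys = Suc n \<Longrightarrow> P (var 0 ys) (tl ys) \<longleftrightarrow> F ys = 0"
    unfolding decidable_def computable_def by blast
  have "rec_eval (Mu p) xs (LEAST i. P i xs)" if xs: "length xs = n" for xs
  proof (rule rec_eval.Mu)
    have "P (LEAST i. P i xs) xs" using assms(2) by (rule LeastI_ex)
    then show "rec_eval p ((LEAST i. P i xs) # xs) 0"
      using F[of "(LEAST i. P i xs) # xs"] xs by simp
  next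
    fix m assume "m < (LEAST i. P i xs)"
    then have "\<not> P m xs" by (rule not_less_Least)
    then show "\<exists>k. rec_eval p (m # xs) (Suc k)"
      using F[of "m # xs"] xs by (metis var_Cons(1) list.sel(3) length_Cons not0_implies_Suc)
  qed
  then show ?thesis unfolding computable_def by blast
qed

text \<open>The search for a witness halts exactly on the projection of the relation.\<close>

lemma ce_set_Collect_Ex:
  assumes "decidable 2 (\<lambda>ys. P (var 0 ys) (var 1 ys))"
  shows "ce_set {x. \<exists>n. P n x}"
proof -
  from assms obtain F p where F: "\<And>ys. length ys = 2 \<Longrightarrow> rec_eval p ys (F ys)"
    "\<And>ys. length ys = 2 \<Longrightarrow> P (var 0 ys) (var 1 ys) \<longleftrightarrow> F ys = 0"
    unfolding decidable_def computable_def by blast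
  have F': "rec_eval p [n, x] (F [n, x])" "P n x \<longleftrightarrow> F [n, x] = 0" for n x
    using F[of "[n, x]"] by auto
  have "(\<exists>n. P n x) \<longleftrightarrow> (\<exists>y. rec_eval (Mu p) [x] y)" for x
  proof
    assume ex: "\<exists>n. P n x"
    have "rec_eval (Mu p) [x] (LEAST n. P n x)"
    proof (rule rec_eval.Mu)
      show "rec_eval p [LEAST n. P n x, x] 0" using F' LeastI_ex[OF ex] by metis
      show "\<exists>k. rec_eval p [m, x] (Suc k)" if "m < (LEAST n. P n x)" for m
        using F' not_less_Least[OF that] by (metis not0_implies_Suc)
    qed
    then show "\<exists>y. rec_eval (Mu p) [x] y" ..
  next
    assume "\<exists>y. rec_eval (Mu p) [x] y"
    then obtain y where "rec_eval p [y, x] 0" by (auto elim: rec_eval.cases)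
    \<comment> \<open>Determinism identifies the value 0 found by the search with
      \<open>F [y, x]\<close>.\<close>
    then show "\<exists>n. P n x" using F' rec_eval_deterministic by metis
  qed
  then show ?thesis unfolding ce_set_def by auto
qed

lemma decidable_const: "decidable n (\<lambda>_. b)"
  unfolding decidable_def
  by (intro exI[of _ "\<lambda>_. if b then 0 else 1"]) (auto intro: computable_const)

lemma decidable_map_eq:
  assumes "\<And>l. l \<in> set ls \<Longrightarrow> computable n (G l)"
  shows "decidable n (\<lambda>xs. map (\<lambda>l. G l xs) ls = ys)"
  using assms
proof (induction ls arbitrary: ys)
  case Nil
  show ?case by (simp add: decidable_const)
next
  case (Cons l ls)
  show ?case
  proof (cases ys)
    case Nil
    then show ?thesis by (simp add: decidable_const)
  next
    case (Cons y ys')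
    then show ?thesis
      using Cons.IH[of ys'] Cons.prems
      by (auto intro!: decidable_conj decidable_eq computable_const)
  qed
qed

text \<open>A finite disjunction of comparisons with constants. In this way the local rule enters a
  program as a table.\<close>

lemma decidable_map_in:
  assumes "finite S" "\<And>l. l \<in> set ls \<Longrightarrow> computable n (G l)"
  shows "decidable n (\<lambda>xs. map (\<lambda>l. G l xs) ls \<in> S)"
  using assms(1)
proof (induction S)
  case (insert ys S)
  then show ?case by (auto intro!: decidable_disj decidable_map_eq assms(2))
qed (simp add: decidable_const)

lemma computable_mod:
  assumes "computable n F" "computable n G" "\<And>xs. G xs > 0"
  shows "computable n (\<lambda>xs. F xs mod G xs)"
proof -
  have D: "decidable (Suc n) (\<lambda>ys. F (tl ys) < Suc (var 0 ys) * G (tl ys))"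
    by (intro decidable_less computable_mult computable_Suc computable_var computable_weaken assms)
       simp
  \<comment> \<open>The quotient is the least such \<open>q\<close>; the remainder is then a
    truncated difference.\<close>
  have *: "F xs < Suc q * G xs \<longleftrightarrow> F xs div G xs \<le> q" for q xs
    using assms(3)[of xs] by (metis div_less_iff_less_mult less_Suc_eq_le)
  then have "\<exists>q. F xs < Suc q * G xs" for xs by blast
  then have "computable n (\<lambda>xs. LEAST q. F xs < Suc q * G xs)"
    by (intro computable_Least) (use D in auto)
  moreover have "(LEAST q. F xs < Suc q * G xs) = F xs div G xs" for xs
    unfolding * by (rule Least_equality) auto
  ultimately have "computable n (\<lambda>xs. F xs - F xs div G xs * G xs)"
    using assms by (auto intro: computable_diff computable_mult)
  then show ?thesis by (simp add: minus_div_mult_eq_mod)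
qed

section \<open>Decoding of pairs and lists\<close>

text \<open>\<open>list_encode\<close> sends the empty list to 0 and a nonempty list to the
  successor of a pair code.\<close>

definition code_hd :: "nat \<Rightarrow> nat" where
  "code_hd x = fst (prod_decode (x - 1))"

definition code_tl :: "nat \<Rightarrow> nat" where
  "code_tl x = snd (prod_decode (x - 1))"

lemma computable_prod_decode:
  assumes "computable n F"
  shows "computable n (\<lambda>xs. fst (prod_decode (F xs)))" "computable n (\<lambda>xs. snd (prod_decode (F xs)))"
proof -
  have tri: "computable m (\<lambda>xs. triangle (G xs))" if "computable m G" for m G
  proof -
    have "triangle k = (\<Sum>i<k. Suc i)" for k
      by (induction k) auto
    then show ?thesis
      using computable_bounded_sum[OF that, of "\<lambda>i xs. Suc i"]
      by (simp add: computable_Suc computable_var)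
  qed
  \<comment> \<open>The Cantor pairing sends \<open>(b, c)\<close> to
    \<open>triangle (b + c) + b\<close>; \<open>r\<close> recovers the diagonal \<open>b + c\<close>
    by search.\<close>
  define r where "r = (\<lambda>a. LEAST k. a < triangle (Suc k))"
  have r: "r a = fst (prod_decode a) + snd (prod_decode a)" for a
  proof -
    obtain b c where bc: "prod_decode a = (b, c)" by fastforce
    then have a: "a = triangle (b + c) + b"
      using prod_decode_inverse[of a] by (simp add: prod_encode_def)
    have mono: "triangle i \<le> triangle j" if "i \<le> j" for i j
      using that by (induction rule: dec_induct) auto
    have "r a = b + c" unfolding r_def
    proof (rule Least_equality)
      fix k assume "a < triangle (Suc k)"
      then show "b + c \<le> k" using a mono[of "Suc k" "b + c"] by (cases "Suc k \<le> b + c") auto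
    qed (simp add: a)
    with bc show ?thesis by simp
  qed
  have D: "decidable (Suc n) (\<lambda>ys. F (tl ys) < triangle (Suc (var 0 ys)))"
    by (intro decidable_less tri computable_Suc computable_var computable_weaken assms) simp
  have "computable n (\<lambda>xs. r (F xs))"
    unfolding r_def
  proof (rule computable_Least[OF D])
    show "\<exists>i. F xs < triangle (Suc i)" for xs
      by (intro exI[of _ "F xs"]) simp
  qed
  note c = this tri[OF this] assms
  have fst: "fst (prod_decode a) = a - triangle (r a)" for a
    using prod_decode_inverse[of a] unfolding r
    by (cases "prod_decode a") (simp add: prod_encode_def)
  show 1: "computable n (\<lambda>xs. fst (prod_decode (F xs)))"
    unfolding fst by (intro computable_diff c)
  have "snd (prod_decode a) = r a - fst (prod_decode a)" for a by (simp add: r)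
  with 1 c show "computable n (\<lambda>xs. snd (prod_decode (F xs)))" by (simp add: computable_diff)
qed

definition code_drop :: "nat \<Rightarrow> nat \<Rightarrow> nat" where
  "code_drop i x = (code_tl ^^ i) x"

definition code_nth :: "nat \<Rightarrow> nat \<Rightarrow> nat" where
  "code_nth x i = code_hd (code_drop i x)"

lemma computable_code_drop:
  assumes "computable n F" "computable n G"
  shows "computable n (\<lambda>xs. code_drop (G xs) (F xs))"
proof -
  have "rec_nat a (\<lambda>i r. code_tl r) k = code_drop k a" for a k
    unfolding code_drop_def by (induction k) auto
  then show ?thesis
    using computable_rec[OF assms(2,1), of "\<lambda>i r xs. code_tl r"]
      computable_prod_decode(2)[OF computable_pred[OF computable_var]]
    by (simp add: code_tl_def)
qed

lemma computable_code_nth: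
  assumes "computable n F" "computable n G"
  shows "computable n (\<lambda>xs. code_nth (F xs) (G xs))"
  unfolding code_nth_def code_hd_def
  by (intro computable_prod_decode computable_pred computable_code_drop assms)

lemma code_drop_list_encode: "code_drop i (list_encode ys) = list_encode (drop i ys)"
proof -
  have *: "code_tl (list_encode zs) = list_encode (tl zs)" for zs
  proof (cases zs)
    case Nil
    \<comment> \<open>The decoded tail of the empty list is again empty, so dropping too many
      entries is harmless.\<close>
    have "prod_decode 0 = (0, 0)" by (simp add: prod_decode_def prod_decode_aux.simps)
    with Nil show ?thesis by (simp add: code_tl_def)
  qed (simp add: code_tl_def)
  show ?thesis
    unfolding code_drop_def by (induction i) (auto simp: * tl_drop drop_Suc)
qed

text \<open>As 0 codes only the empty list, this tests whether an index is in range without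
  computing a length.\<close>

lemma code_drop_list_encode_eq_0: "code_drop i (list_encode ys) = 0 \<longleftrightarrow> length ys \<le> i"
  unfolding code_drop_list_encode by (cases "drop i ys") auto

lemma code_nth_list_encode: "i < length ys \<Longrightarrow> code_nth (list_encode ys) i = ys ! i"
  unfolding code_nth_def code_drop_list_encode by (subst Cons_nth_drop_Suc[symmetric]) (auto simp: code_hd_def)

text \<open>Lets the code of a word bound the quantifier over its positions.\<close>

lemma length_le_list_encode: "length ys \<le> list_encode ys"
proof (induction ys)
  case (Cons y ys)
  then show ?case using le_prod_encode_2[of "list_encode ys" y] by simp
qed simp

section \<open>Baire category in the full shift\<close>

text \<open>These equivalence relations replace the ultrametric: their classes are the cylinders
  around the origin, which are clopen and form a base.\<close>

definition agree :: "nat \<Rightarrow> (int \<Rightarrow> 'a) \<Rightarrow> (int \<Rightarrow> 'a) \<Rightarrow> bool" where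
  "agree n x y \<longleftrightarrow> (\<forall>i. \<bar>i\<bar> \<le> int n \<longrightarrow> x i = y i)"

lemma agree_refl [simp]: "agree n x x"
  by (simp add: agree_def)

lemma agree_sym: "agree n x y \<Longrightarrow> agree n y x"
  by (simp add: agree_def)

lemma agree_trans: "agree n x y \<Longrightarrow> agree n y z \<Longrightarrow> agree n x z"
  by (simp add: agree_def)

lemma agree_mono: "agree n x y \<Longrightarrow> m \<le> n \<Longrightarrow> agree m x y"
  by (auto simp: agree_def)

lemma agree_imp_shift_dist_le: "agree n x y \<Longrightarrow> shift_dist x y \<le> (1 / 2) ^ n"
  by (rule shift_dist_le) (auto simp: agree_def)

lemma shift_dist_less_imp_agree: "shift_dist x y < (1 / 2) ^ n \<Longrightarrow> agree n x y"
  using shift_dist_less_agree[of x y n] by (auto simp: agree_def abs_le_iff)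

lemma agree_imp_shift_dist_less:
  assumes "r > 0"
  obtains n where "\<And>x y. agree n x y \<Longrightarrow> shift_dist x y < r"
proof -
  obtain n where "(1 / 2 :: real) ^ n < r"
    using real_arch_pow_inv[OF assms, of "1 / 2"] by auto
  then show thesis using that[of n] agree_imp_shift_dist_le by (meson le_less_trans)
qed

lemma topspace_full_shift [simp]: "topspace full_shift = UNIV"
  by (simp add: full_shift_def)

lemma openin_full_shift:
  "openin full_shift U \<longleftrightarrow> (\<forall>x\<in>U. \<exists>n. \<forall>y. agree n x y \<longrightarrow> y \<in> U)"
proof -
  have "(\<exists>r>0. shift_metric.mball x r \<subseteq> U) \<longleftrightarrow> (\<exists>n. \<forall>y. agree n x y \<longrightarrow> y \<in> U)" for x
  proof
    assume "\<exists>r>0. shift_metric.mball x r \<subseteq> U"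
    then show "\<exists>n. \<forall>y. agree n x y \<longrightarrow> y \<in> U"
      by (metis agree_imp_shift_dist_less UNIV_I shift_metric.in_mball subsetD)
  next
    assume "\<exists>n. \<forall>y. agree n x y \<longrightarrow> y \<in> U"
    then obtain n where "\<And>y. agree n x y \<Longrightarrow> y \<in> U" by blast
    then show "\<exists>r>0. shift_metric.mball x r \<subseteq> U"
      by (intro exI[of _ "(1 / 2) ^ n"]) (auto simp: shift_metric.in_mball dest!: shift_dist_less_imp_agree)
  qed
  then show ?thesis
    unfolding mtopology_shift_dist[symmetric] shift_metric.openin_mtopology by auto
qed

lemma closedin_full_shift: "closedin full_shift C \<longleftrightarrow> openin full_shift (- C)"
  by (simp add: closedin_def Compl_eq_Diff_UNIV)

lemma openin_window:
  assumes "\<And>x y. agree n x y \<Longrightarrow> x \<in> U \<Longrightarrow> y \<in> U"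
  shows "openin full_shift U"
  unfolding openin_full_shift using assms by blast

lemma closedin_window:
  assumes "\<And>x y. agree n x y \<Longrightarrow> x \<in> U \<Longrightarrow> y \<in> U"
  shows "closedin full_shift U"
  unfolding closedin_full_shift
  by (rule openin_window[of n]) (use assms agree_sym in blast)

lemma compact_space_full_shift: "compact_space (full_shift :: (int \<Rightarrow> 'a::finite) topology)"
  unfolding full_shift_def
  by (simp add: compact_space_product_topology compact_space_discrete_topology)

text \<open>Compactness in the form used to turn radii that depend on the point into uniform
  ones.\<close>

lemma compact_cover:
  fixes K :: "(int \<Rightarrow> 'a::finite) set"
  assumes "closedin full_shift K"
  obtains F where "finite F" "F \<subseteq> K" "\<And>y. y \<in> K \<Longrightarrow> \<exists>x\<in>F. agree (n x) x y"
proof -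
  have "compactin full_shift K"
    using compact_space_full_shift assms by (rule closedin_compact_space)
  moreover have "openin full_shift {y. agree (n x) x y}" for x
    by (rule openin_window) (auto intro: agree_trans)
  moreover have "K \<subseteq> \<Union>((\<lambda>x. {y. agree (n x) x y}) ` K)" by auto
  ultimately obtain \<F> where \<F>: "finite \<F>" "\<F> \<subseteq> (\<lambda>x. {y. agree (n x) x y}) ` K" "K \<subseteq> \<Union>\<F>"
    using compactinD[of full_shift K "(\<lambda>x. {y. agree (n x) x y}) ` K"] by blast
  from \<F>(1,2) obtain F where "F \<subseteq> K" "finite F" "\<F> = (\<lambda>x. {y. agree (n x) x y}) ` F"
    by (meson finite_subset_image)
  with \<F>(3) show thesis by (intro that[of F]) auto
qed

lemma comeager_in_mono: "comeager_in X S \<Longrightarrow> S \<subseteq> T \<Longrightarrow> comeager_in X T"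
  unfolding comeager_in_def by (meson subset_trans)

lemma comeager_in_INT:
  assumes "countable I" "\<And>i. i \<in> I \<Longrightarrow> comeager_in X (S i)"
  shows "comeager_in X (\<Inter>i\<in>I. S i)"
proof -
  obtain \<U> where \<U>: "\<And>i. i \<in> I \<Longrightarrow> countable (\<U> i) \<and>
      (\<forall>U\<in>\<U> i. openin X U \<and> X closure_of U = topspace X) \<and> topspace X \<inter> \<Inter>(\<U> i) \<subseteq> S i"
    using assms(2) unfolding comeager_in_def by metis
  show ?thesis
    unfolding comeager_in_def
    by (intro exI[of _ "\<Union>i\<in>I. \<U> i"]) (use \<U> assms(1) in \<open>auto intro!: countable_UN\<close>, blast)
qed

lemma comeager_in_Int: "comeager_in X S \<Longrightarrow> comeager_in X T \<Longrightarrow> comeager_in X (S \<inter> T)"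
  using comeager_in_INT[of UNIV X "\<lambda>b. if b then S else T"]
    INT_bool_eq[of "\<lambda>b. if b then S else T"] by (simp only: if_True if_False) simp

lemma comeager_in_dense_open:
  "openin X U \<Longrightarrow> X closure_of U = topspace X \<Longrightarrow> comeager_in X U"
  unfolding comeager_in_def by (intro exI[of _ "{U}"]) auto

text \<open>Baire's theorem, available because a compact metric space is complete.\<close>

lemma comeager_full_shift_meets:
  fixes S :: "(int \<Rightarrow> 'a::finite) set"
  assumes "comeager_in full_shift S"
  obtains y where "y \<in> S" "agree n x y"
proof -
  from assms obtain \<U> where \<U>: "countable \<U>" "\<Inter>\<U> \<subseteq> S"
    "\<And>U. U \<in> \<U> \<Longrightarrow> openin full_shift U \<and> full_shift closure_of U = topspace full_shift"
    unfolding comeager_in_def by auto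
  have "shift_metric.mcomplete TYPE('a)"
    using compact_space_full_shift unfolding mtopology_shift_dist[symmetric]
    by (rule shift_metric.compact_space_imp_mcomplete)
  then have "full_shift closure_of \<Inter>\<U> = topspace full_shift"
    using shift_metric.metric_Baire_category[of \<U>] \<U> unfolding mtopology_shift_dist by simp
  moreover have "openin full_shift {y. agree n x y}"
    by (rule openin_window) (auto intro: agree_trans)
  moreover have "{y. agree n x y} \<noteq> {}" using agree_refl by blast
  ultimately have "\<Inter>\<U> \<inter> {y. agree n x y} \<noteq> {}" unfolding dense_intersects_open by blast
  with \<U>(2) that show thesis by blast
qed

section \<open>Recurrent visits and the generic limit set\<close>

definition finitely_often :: "('b \<Rightarrow> 'b) \<Rightarrow> 'b set \<Rightarrow> 'b set" where
  "finitely_often f Z = {x. finite {t. (f ^^ t) x \<in> Z}}"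

text \<open>An orbit that eventually leaves the open set \<open>Z\<close> has no limit point there,
  so \<open>- Z\<close> is one of the closed sets intersected in
  \<open>generic_limit_set\<close>.\<close>

lemma generic_limit_set_disjoint:
  assumes Z: "openin full_shift Z" and "comeager_in full_shift (finitely_often f Z)"
  shows "Z \<inter> generic_limit_set f = {}"
proof -
  have "finitely_often f Z \<subseteq> realm f (- Z)"
  proof
    fix x assume x: "x \<in> finitely_often f Z"
    show "x \<in> realm f (- Z)"
      unfolding realm_def omega_limit_def
    proof safe
      fix y r assume r: "strict_mono r" and lim: "limitin full_shift (\<lambda>n. (f ^^ r n) x) y sequentially"
        and "y \<in> Z"
      with Z obtain N where "\<And>n. n \<ge> N \<Longrightarrow> (f ^^ r n) x \<in> Z"
        unfolding limitin_def eventually_sequentially by blast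
      then have "r ` {N..} \<subseteq> {t. (f ^^ t) x \<in> Z}" by auto
      with x have "finite (r ` {N..})"
        unfolding finitely_often_def using finite_subset by blast
      moreover have "inj_on r {N..}" using inj_on_subset[OF strict_mono_on_imp_inj_on[OF r]] by blast
      ultimately show False using finite_imageD infinite_Ici by blast
    qed
  qed
  then have "comeager_in full_shift (realm f (- Z))" using assms(2) comeager_in_mono by blast
  moreover have "closedin full_shift (- Z)" using Z by (simp add: closedin_full_shift)
  ultimately show ?thesis unfolding generic_limit_set_def by blast
qed

text \<open>By compactness, infinitely many visits to the closed set \<open>Z\<close> would produce
  a limit point in \<open>Z\<close>.\<close>

lemma realm_subset_finitely_often:
  fixes f :: "(int \<Rightarrow> 'a::finite) \<Rightarrow> (int \<Rightarrow> 'a)"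
  assumes Z: "closedin full_shift Z" and "Z \<inter> C = {}"
  shows "realm f C \<subseteq> finitely_often f Z"
proof
  fix x assume x: "x \<in> realm f C"
  show "x \<in> finitely_often f Z"
  proof (rule ccontr)
    let ?T = "{t. (f ^^ t) x \<in> Z}"
    assume "x \<notin> finitely_often f Z"
    then have inf: "infinite ?T" by (simp add: finitely_often_def)
    have "compactin full_shift Z"
      using compact_space_full_shift Z by (rule closedin_compact_space)
    then have seq: "range \<sigma> \<subseteq> Z \<Longrightarrow>
        \<exists>l r. l \<in> Z \<and> strict_mono r \<and> limitin full_shift (\<sigma> \<circ> r) l sequentially"
      for \<sigma> :: "nat \<Rightarrow> int \<Rightarrow> 'a"
      using shift_metric.compactin_sequentially[of Z] unfolding mtopology_shift_dist by simp
    have "range (\<lambda>n. (f ^^ enumerate ?T n) x) \<subseteq> Z"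
      using enumerate_in_set[OF inf] by auto
    from seq[OF this] obtain y r where y: "y \<in> Z" and r: "strict_mono r"
      and lim: "limitin full_shift ((\<lambda>n. (f ^^ enumerate ?T n) x) \<circ> r) y sequentially"
      by blast
    have "strict_mono (enumerate ?T \<circ> r)"
      using r inf by (intro strict_mono_o) (simp_all add: strict_mono_enumerate)
    then have "y \<in> omega_limit f x"
      unfolding omega_limit_def using lim
      by (auto intro!: exI[of _ "enumerate ?T \<circ> r"] simp: comp_def)
    with x y assms(2) show False by (auto simp: realm_def)
  qed
qed

text \<open>Each point of \<open>Z\<close> is missed by some closed set with comeager realm, hence
  has a cylinder that generic points visit only finitely often. Finitely many such cylinders cover
  \<open>Z\<close>.\<close>

lemma comeager_finitely_often:
  fixes f :: "(int \<Rightarrow> 'a::finite) \<Rightarrow> (int \<Rightarrow> 'a)"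
  assumes Z: "closedin full_shift Z" and disj: "Z \<inter> generic_limit_set f = {}"
  shows "comeager_in full_shift (finitely_often f Z)"
proof -
  have "\<exists>n. comeager_in full_shift (finitely_often f {z. agree n y z})" if "y \<in> Z" for y
  proof -
    from that disj obtain C where C: "closedin full_shift C" "comeager_in full_shift (realm f C)" "y \<notin> C"
      unfolding generic_limit_set_def by blast
    have "openin full_shift (- C)" using C(1) by (simp add: closedin_full_shift)
    with C(3) obtain n where n: "\<And>z. agree n y z \<Longrightarrow> z \<notin> C"
      unfolding openin_full_shift by blast
    have "closedin full_shift {z. agree n y z}"
      by (rule closedin_window) (auto intro: agree_trans)
    then have "realm f C \<subseteq> finitely_often f {z. agree n y z}"
      by (rule realm_subset_finitely_often) (use n in auto)
    with C(2) show ?thesis using comeager_in_mono by blast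
  qed
  then obtain n where n: "\<And>y. y \<in> Z \<Longrightarrow> comeager_in full_shift (finitely_often f {z. agree (n y) y z})"
    by metis
  obtain F where F: "finite F" "F \<subseteq> Z" "\<And>z. z \<in> Z \<Longrightarrow> \<exists>y\<in>F. agree (n y) y z"
    using compact_cover[OF Z, of n] by blast
  have "comeager_in full_shift (\<Inter>y\<in>F. finitely_often f {z. agree (n y) y z})"
    by (rule comeager_in_INT) (use n F in \<open>auto intro: countable_finite\<close>)
  moreover have "(\<Inter>y\<in>F. finitely_often f {z. agree (n y) y z}) \<subseteq> finitely_often f Z"
  proof
    fix x assume "x \<in> (\<Inter>y\<in>F. finitely_often f {z. agree (n y) y z})"
    then have "finite (\<Union>y\<in>F. {t. agree (n y) y ((f ^^ t) x)})"
      using F(1) by (auto simp: finitely_often_def)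
    moreover have "{t. (f ^^ t) x \<in> Z} \<subseteq> (\<Union>y\<in>F. {t. agree (n y) y ((f ^^ t) x)})"
      using F(3) by blast
    ultimately show "x \<in> finitely_often f Z"
      unfolding finitely_often_def using finite_subset by blast
  qed
  ultimately show ?thesis by (rule comeager_in_mono)
qed

lemma closedin_generic_limit_set: "closedin full_shift (generic_limit_set f)"
proof -
  \<comment> \<open>The family intersected is nonempty, as it contains the whole space.\<close>
  have "realm f UNIV = UNIV" by (auto simp: realm_def)
  moreover have "comeager_in full_shift (UNIV :: (int \<Rightarrow> 'a) set)"
    using comeager_in_dense_open[of full_shift UNIV] openin_topspace[of full_shift]
      closure_of_topspace[of full_shift] by simp
  ultimately show ?thesis
    unfolding generic_limit_set_def
    by (intro closedin_Inter) (auto intro!: exI[of _ UNIV] closedin_topspace[of full_shift, simplified])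
qed

section \<open>Blocking words\<close>

definition translate :: "int \<Rightarrow> (int \<Rightarrow> 'a) \<Rightarrow> (int \<Rightarrow> 'a)" where
  "translate c x = (\<lambda>i. x (i + c))"

locale ca =
  fixes f :: "(int \<Rightarrow> 'a::finite) \<Rightarrow> (int \<Rightarrow> 'a)" and R :: nat
  assumes radius: "agree R x y \<Longrightarrow> f x 0 = f y 0"
    and f_translate: "f (translate c x) = translate c (f x)"

text \<open>The Curtis-Hedlund-Lyndon theorem: continuity gives each point a window that decides
  \<open>f x 0\<close>, and compactness gives a common one.\<close>

lemma cellular_automaton_imp_ca:
  fixes f :: "(int \<Rightarrow> 'a::finite) \<Rightarrow> (int \<Rightarrow> 'a)"
  assumes "cellular_automaton f"
  obtains R where "ca f R"
proof -
  have cont: "continuous_map full_shift full_shift f" and sh: "\<And>x. f (shift x) = shift (f x)"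
    using assms by (auto simp: cellular_automaton_def)
  have "\<exists>n. \<forall>y. agree n x y \<longrightarrow> f y 0 = f x 0" for x
  proof -
    have "openin full_shift {z. z 0 = f x 0}"
      by (rule openin_window[of 0]) (auto simp: agree_def)
    then have "openin full_shift {y. f y 0 = f x 0}"
      using openin_continuous_map_preimage[OF cont] by fastforce
    then show ?thesis unfolding openin_full_shift by blast
  qed
  then obtain n where n: "\<And>x y. agree (n x) x y \<Longrightarrow> f y 0 = f x 0" by metis
  have "closedin full_shift (UNIV :: (int \<Rightarrow> 'a) set)" by (rule closedin_window) auto
  from compact_cover[OF this, of n]
  obtain F where F: "finite F" "\<And>y. \<exists>x\<in>F. agree (n x) x y" by auto
  define R where "R = Max (n ` F)"
  have "f x 0 = f y 0" if "agree R x y" for x y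
  proof -
    obtain z where z: "z \<in> F" "agree (n z) z x" using F by blast
    then have "n z \<le> R" unfolding R_def using F(1) by simp
    with that z(2) have "agree (n z) z y" using agree_trans agree_mono by blast
    with z n show ?thesis by metis
  qed
  moreover have "f (translate c x) = translate c (f x)" for c x
  proof (induction c rule: int_induct[where k = 0])
    case base
    show ?case by (simp add: translate_def)
  next
    case (step1 i)
    have "translate (i + 1) y = shift (translate i y)" for y :: "int \<Rightarrow> 'a"
      by (simp add: translate_def shift_def algebra_simps)
    with step1 sh show ?case by simp
  next
    \<comment> \<open>Negative translations are reached by cancelling the injective map
      \<open>shift\<close>.\<close>
    case (step2 i)
    have "translate i y = shift (translate (i - 1) y)" for y :: "int \<Rightarrow> 'a"
      by (simp add: translate_def shift_def algebra_simps)
    with step2 sh have "shift (f (translate (i - 1) x)) = shift (translate (i - 1) (f x))" by metis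
    then have "f (translate (i - 1) x) (j + 1) = translate (i - 1) (f x) (j + 1)" for j
      unfolding shift_def by metis
    then have "f (translate (i - 1) x) j = translate (i - 1) (f x) j" for j
      by (metis diff_add_cancel)
    then show ?case by blast
  qed
  ultimately show thesis by (intro that[of R]) (simp add: ca_def)
qed

context ca
begin

lemma funpow_translate: "(f ^^ t) (translate c x) = translate c ((f ^^ t) x)"
  by (induction t) (simp_all add: f_translate)

lemma f_local:
  assumes "\<And>j. \<bar>j - i\<bar> \<le> int R \<Longrightarrow> x j = y j"
  shows "f x i = f y i"
proof -
  have "agree R (translate i x) (translate i y)"
    using assms by (auto simp: agree_def translate_def)
  from radius[OF this] show ?thesis by (simp add: f_translate) (simp add: translate_def)
qed

lemma agree_f: "agree (n + R) x y \<Longrightarrow> agree n (f x) (f y)"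
  unfolding agree_def by (intro allI impI f_local) auto

text \<open>Information travels at most \<open>R\<close> cells per step.\<close>

lemma agree_funpow: "agree (n + t * R) x y \<Longrightarrow> agree n ((f ^^ t) x) ((f ^^ t) y)"
proof (induction t arbitrary: n)
  case (Suc t)
  then have "agree (n + R) ((f ^^ t) x) ((f ^^ t) y)"
    by (intro Suc.IH) (simp add: algebra_simps)
  then show ?case using agree_f by simp
qed simp

lemma agree_funpow_uniform:
  assumes "agree (n + T * R) x y" "t \<le> T"
  shows "agree n ((f ^^ t) x) ((f ^^ t) y)"
  using assms by (intro agree_funpow) (auto elim!: agree_mono)

section \<open>Consequences of equicontinuity\<close>

lemma uniformly_equicontinuous:
  assumes X: "closedin full_shift X" and eq: "equicontinuous_restriction f X"
  obtains r where "\<And>x y t. x \<in> X \<Longrightarrow> y \<in> X \<Longrightarrow> agree r x y \<Longrightarrow> agree m ((f ^^ t) x) ((f ^^ t) y)"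
proof -
  have "\<exists>n. \<forall>y\<in>X. agree n x y \<longrightarrow> (\<forall>t. agree m ((f ^^ t) x) ((f ^^ t) y))" if "x \<in> X" for x
  proof -
    have "(1 / 2 :: real) ^ m > 0" by simp
    with eq that obtain \<delta> where \<delta>: "\<delta> > 0"
      "\<And>y t. y \<in> X \<Longrightarrow> shift_dist x y < \<delta> \<Longrightarrow> shift_dist ((f ^^ t) x) ((f ^^ t) y) < (1 / 2) ^ m"
      unfolding equicontinuous_restriction_def by metis
    from agree_imp_shift_dist_less[OF \<delta>(1)] obtain n where
      "\<And>y. agree n x y \<Longrightarrow> shift_dist x y < \<delta>" by metis
    with \<delta>(2) show ?thesis using shift_dist_less_imp_agree by blast
  qed
  then obtain n where n: "\<And>x y t. x \<in> X \<Longrightarrow> y \<in> X \<Longrightarrow> agree (n x) x y \<Longrightarrow>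
      agree m ((f ^^ t) x) ((f ^^ t) y)"
    by metis
  obtain F where F: "finite F" "F \<subseteq> X" "\<And>y. y \<in> X \<Longrightarrow> \<exists>x\<in>F. agree (n x) x y"
    using compact_cover[OF X, of n] by blast
  define r where "r = Max (n ` F)"
  have "agree m ((f ^^ t) x) ((f ^^ t) y)" if xy: "x \<in> X" "y \<in> X" "agree r x y" for x y t
  proof -
    obtain z where z: "z \<in> F" "agree (n z) z x" using F xy by blast
    then have "n z \<le> r" unfolding r_def using F(1) by simp
    with xy z(2) have "agree (n z) z y" using agree_trans agree_mono by blast
    moreover have "z \<in> X" using z(1) F(2) by blast
    ultimately show ?thesis using n[of z x t] n[of z y t] z(2) xy(1,2) agree_trans agree_sym by metis
  qed
  then show thesis by (rule that)
qed

text \<open>On \<open>X\<close> the window of radius \<open>r\<close> determines the window of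
  radius \<open>m\<close> at every time. There are only finitely many such dependencies, so two
  times \<open>a < b\<close> share one.\<close>

lemma eventually_periodic:
  assumes "closedin full_shift X" and "equicontinuous_restriction f X"
  obtains q p where "p > 0" "\<And>x. x \<in> X \<Longrightarrow> agree m ((f ^^ (q + p)) x) ((f ^^ q) x)"
proof -
  obtain r where r: "\<And>x y t. x \<in> X \<Longrightarrow> y \<in> X \<Longrightarrow> agree r x y \<Longrightarrow> agree m ((f ^^ t) x) ((f ^^ t) y)"
    using uniformly_equicontinuous[OF assms] by metis
  define win where "win = (\<lambda>(n::nat) (x :: int \<Rightarrow> 'a). restrict x {- int n..int n})"
  have win: "win n x = win n y \<longleftrightarrow> agree n x y" for n x y
    unfolding win_def agree_def restrict_def fun_eq_iff by (auto simp: abs_le_iff) 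
  \<comment> \<open>The graph of the dependency at time \<open>t\<close>, a subset of a fixed finite
    set.\<close>
  define g where "g = (\<lambda>t. {(win r x, win m ((f ^^ t) x)) | x. x \<in> X})"
  have fin: "finite (range (win n))" for n
  proof (rule finite_subset)
    show "range (win n) \<subseteq> ({- int n..int n} \<rightarrow>\<^sub>E UNIV)" by (auto simp: win_def)
    show "finite ({- int n..int n} \<rightarrow>\<^sub>E (UNIV :: 'a set))" by (rule finite_PiE) auto
  qed
  have "range g \<subseteq> Pow (range (win r) \<times> range (win m))" by (auto simp: g_def)
  then have "finite (range g)" by (rule finite_subset) (simp add: fin)
  then have "\<not> inj g" using finite_imageD infinite_UNIV_nat by blast
  then obtain a b where ab: "a < b" "g a = g b" unfolding inj_def by (metis nat_neq_iff)
  have "agree m ((f ^^ b) x) ((f ^^ a) x)" if "x \<in> X" for x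
  proof -
    have "(win r x, win m ((f ^^ a) x)) \<in> g b" unfolding ab(2)[symmetric] using that by (auto simp: g_def)
    \<comment> \<open>The equality of graphs only yields some \<open>y\<close> with the same window
      as \<open>x\<close>; equicontinuity replaces it by \<open>x\<close>.\<close>
    then obtain y where "y \<in> X" "agree r x y" "agree m ((f ^^ a) x) ((f ^^ b) y)"
      unfolding g_def by (auto simp: win)
    then show ?thesis using r[OF that] agree_trans agree_sym by metis
  qed
  with ab(1) show thesis by (intro that[of "b - a" a]) auto
qed

text \<open>The word is \<open>z0\<close> on \<open>[-k, k]\<close>; its occurrence centred at
  \<open>c\<close> in \<open>x\<close> reads \<open>agree k z0 (translate c x)\<close>.\<close>

definition blocking :: "nat \<Rightarrow> (int \<Rightarrow> 'a) \<Rightarrow> bool" where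
  "blocking k z0 \<longleftrightarrow> (\<forall>z t. agree k z0 z \<longrightarrow> agree R ((f ^^ t) z0) ((f ^^ t) z))"

text \<open>A point that stays close to \<open>X\<close> from time \<open>T\<close> on need not shadow a single orbit of \<open>X\<close>. But over
  \<open>q + p\<close> steps it follows the orbit of one point of \<open>X\<close>, so its central column is eventually
  \<open>p\<close>-periodic.\<close>

lemma blocking_exists:
  assumes eq: "equicontinuous_restriction f (generic_limit_set f)"
  obtains k z0 where "blocking k z0"
proof -
  let ?X = "generic_limit_set f"
  obtain q p where p: "p > 0"
    and per: "\<And>x. x \<in> ?X \<Longrightarrow> agree R ((f ^^ (q + p)) x) ((f ^^ q) x)"
    using eventually_periodic[OF closedin_generic_limit_set eq] by metis
  \<comment> \<open>Agreement on radius \<open>N\<close> leaves agreement on radius \<open>R\<close>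
    throughout \<open>q + p\<close> steps.\<close>
  define N where "N = R + (q + p) * R"
  define Z where "Z = {z. \<not> (\<exists>y\<in>?X. agree N y z)}"
  have Z: "openin full_shift Z" "closedin full_shift Z"
    unfolding Z_def
    by (rule openin_window[of N] closedin_window[of N]; auto intro: agree_trans agree_sym)+
  have "Z \<inter> ?X = {}" unfolding Z_def using agree_refl by blast
  with Z(2) have "comeager_in full_shift (finitely_often f Z)" by (rule comeager_finitely_often)
  \<comment> \<open>Otherwise, for every \<open>T\<close>, the points visiting \<open>Z\<close> at
    or after time \<open>T\<close> form a dense open set. By Baire's theorem some point would visit
    \<open>Z\<close> infinitely often and finitely often at once.\<close>
  obtain z0 k0 T where T: "\<And>z t. agree k0 z0 z \<Longrightarrow> t \<ge> T \<Longrightarrow> (f ^^ t) z \<notin> Z"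
  proof (rule ccontr)
    assume "\<not> thesis"
    then have *: "\<exists>z t. agree n x z \<and> t \<ge> T \<and> (f ^^ t) z \<in> Z" for n x T using that by metis
    define V where "V = (\<lambda>T. {z. \<exists>t\<ge>T. (f ^^ t) z \<in> Z})"
    have "comeager_in full_shift (V T)" for T
    proof (rule comeager_in_dense_open)
      have "z' \<in> V T" if "t \<ge> T" "(f ^^ t) z \<in> Z" "agree (N + t * R) z z'" for t z z'
      proof -
        from that(3) have "agree N ((f ^^ t) z) ((f ^^ t) z')" by (rule agree_funpow)
        with that(2) have "(f ^^ t) z' \<in> Z" unfolding Z_def using agree_trans agree_sym by blast
        with that(1) show ?thesis unfolding V_def by blast
      qed
      then show "openin full_shift (V T)"
        unfolding openin_full_shift V_def by blast
      show "full_shift closure_of (V T) = topspace full_shift"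
        unfolding dense_intersects_open
      proof (intro allI impI, elim conjE)
        fix U :: "(int \<Rightarrow> 'a) set" assume "openin full_shift U" "U \<noteq> {}"
        then obtain x n where "\<And>y. agree n x y \<Longrightarrow> y \<in> U" unfolding openin_full_shift by blast
        with *[of n x T] show "V T \<inter> U \<noteq> {}" unfolding V_def by blast
      qed
    qed
    then have "comeager_in full_shift (\<Inter>T\<in>UNIV. V T)" by (intro comeager_in_INT) auto
    with \<open>comeager_in full_shift (finitely_often f Z)\<close>
    have "comeager_in full_shift (finitely_often f Z \<inter> (\<Inter>T\<in>UNIV. V T))"
      by (rule comeager_in_Int)
    then obtain y where "y \<in> finitely_often f Z \<inter> (\<Inter>T\<in>UNIV. V T)"
      by (rule comeager_full_shift_meets)
    then have "y \<in> finitely_often f Z" "\<And>T. y \<in> V T" by auto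
    then show False
      unfolding finitely_often_def V_def finite_nat_set_iff_bounded by auto (meson leD)
  qed
  have per': "agree R ((f ^^ (t + p)) z) ((f ^^ t) z)" if z: "agree k0 z0 z" and t: "t \<ge> T + q" for z t
  proof -
    \<comment> \<open>The shadowing point of \<open>X\<close> is chosen \<open>q\<close> steps
      before \<open>t\<close>, so that its periodicity takes effect at time
      \<open>t\<close>.\<close>
    define s where "s = t - q"
    have s: "t = q + s" "s \<ge> T" using t by (auto simp: s_def)
    from T[OF z s(2)] obtain y where y: "y \<in> ?X" "agree N y ((f ^^ s) z)" unfolding Z_def by blast
    have "agree R ((f ^^ j) y) ((f ^^ j) ((f ^^ s) z))" if "j \<le> q + p" for j
      using agree_funpow_uniform[OF y(2)[unfolded N_def] that] .
    note this[of q, OF le_add1] this[of "q + p", OF order_refl] per[OF y(1)]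
    then have "agree R ((f ^^ (q + p)) ((f ^^ s) z)) ((f ^^ q) ((f ^^ s) z))"
      by (meson agree_trans agree_sym)
    moreover have "(f ^^ (t + p)) z = (f ^^ (q + p)) ((f ^^ s) z)"
    proof -
      have "t + p = q + p + s" using s(1) by simp
      then show ?thesis by (simp only: funpow_add[of "q + p" s f] comp_apply)
    qed
    moreover have "(f ^^ t) z = (f ^^ q) ((f ^^ s) z)" by (simp only: s(1) funpow_add[of q s f] comp_apply)
    ultimately show ?thesis by simp
  qed
  \<comment> \<open>The second term covers all times up to \<open>T + q + p\<close>; later times are
    reduced by \<open>p\<close> through \<open>per'\<close>, applied to both \<open>z0\<close> and
    \<open>z\<close>.\<close>
  define k where "k = max k0 (R + (T + q + p) * R)"
  have "agree R ((f ^^ t) z0) ((f ^^ t) z)" if z: "agree k z0 z" for z t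
  proof (induction t rule: less_induct)
    case (less t)
    have z': "agree k0 z0 z" "agree (R + (T + q + p) * R) z0 z"
      using z by (auto simp: k_def elim!: agree_mono)
    show ?case
    proof (cases "t \<le> T + q + p")
      case True
      with z'(2) show ?thesis by (rule agree_funpow_uniform)
    next
      case False
      define s where "s = t - p"
      have s: "t = s + p" "s < t" "s \<ge> T + q" using False p by (auto simp: s_def)
      from per'[OF z'(1) s(3)] per'[OF agree_refl s(3)] less[OF s(2)]
      show ?thesis unfolding s(1) using agree_trans agree_sym by metis
    qed
  qed
  then have "blocking k z0" unfolding blocking_def by blast
  then show thesis by (rule that)
qed

text \<open>The columns within \<open>R\<close> of \<open>c1\<close> and \<open>c2\<close> are fixed
  by blocking. Between \<open>c1\<close> and \<open>c2\<close> the local rule reads only cells of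
  \<open>[c1 - R, c2 + R]\<close>, so induction on time applies.\<close>

lemma blocked_window:
  assumes k: "blocking k z0" and c: "c1 \<le> c2"
    and b: "agree k z0 (translate c1 x)" "agree k z0 (translate c2 x)"
    and xy: "\<And>i. c1 - int k \<le> i \<Longrightarrow> i \<le> c2 + int k \<Longrightarrow> x i = y i"
    and i: "c1 - int R \<le> i" "i \<le> c2 + int R"
  shows "(f ^^ t) x i = (f ^^ t) y i"
proof -
  have block: "(f ^^ t) x i = (f ^^ t) y i"
    if "agree k z0 (translate c x)" "c = c1 \<or> c = c2" "\<bar>i - c\<bar> \<le> int R" for c i t
  proof -
    have "agree k (translate c x) (translate c y)"
      using that(2) xy c by (auto simp: agree_def translate_def)
    with that(1) have "agree k z0 (translate c y)" by (rule agree_trans)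
    with that(1) k have "agree R ((f ^^ t) (translate c x)) ((f ^^ t) (translate c y))"
      unfolding blocking_def using agree_trans agree_sym by blast
    then have "(f ^^ t) x (j + c) = (f ^^ t) y (j + c)" if "\<bar>j\<bar> \<le> int R" for j
      using that unfolding funpow_translate by (simp add: agree_def translate_def)
    from this[of "i - c"] that(3) show ?thesis by simp
  qed
  show ?thesis using i
  proof (induction t arbitrary: i)
    case 0
    then show ?case
      \<comment> \<open>Should the margin of width \<open>R\<close> exceed the reach
        \<open>k\<close> of \<open>xy\<close>, blocking at time 0 supplies the equality.\<close>
      using block[OF b(1), where t = 0 and i = i] block[OF b(2), where t = 0 and i = i] xy[of i]
      by force
  next
    case (Suc t)
    consider "\<bar>i - c1\<bar> \<le> int R" | "\<bar>i - c2\<bar> \<le> int R" | "c1 \<le> i" "i \<le> c2" using Suc.prems by linarith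
    then show ?case
    proof cases
      case 3
      then have "f ((f ^^ t) x) i = f ((f ^^ t) y) i"
        by (intro f_local Suc.IH) auto
      then show ?thesis by simp
    qed (use block b in blast)+
  qed
qed

section \<open>Periodic configurations and the language\<close>

lemma closedin_cylinder: "closedin full_shift (cylinder w)"
  and openin_cylinder: "openin full_shift (cylinder w)"
  by (rule closedin_window[of "length w"] openin_window[of "length w"];
      auto simp: cylinder_def agree_def)+

lemma translate_periodic:
  assumes "translate W x = x"
  shows "translate (j * W) x = x"
proof -
  have *: "translate (int n * W) x = x" for n
  proof (induction n)
    case (Suc n)
    then show ?case using assms unfolding translate_def fun_eq_iff
      by (metis add.assoc add.commute of_nat_Suc mult.commute distrib_left mult.right_neutral)
  qed (simp add: translate_def)
  show ?thesis
  proof (cases "j \<ge> 0")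
    case True
    with * show ?thesis by (metis nonneg_int_cases)
  next
    case False
    then obtain n where n: "j = - int n" by (metis int_cases2 of_nat_0_le_iff)
    have "x (i + int n * W) = x i" for i using *[of n] unfolding translate_def by metis
    from this[of "_ - int n * W"] show ?thesis by (simp add: n translate_def fun_eq_iff)
  qed
qed

text \<open>If \<open>w\<close> were absent, a generic \<open>y\<close> near \<open>x\<close> would
  visit its cylinder finitely often. But blocking words on both sides make \<open>y\<close> evolve
  like \<open>x\<close> on the window of \<open>w\<close>, where \<open>w\<close> recurs every
  \<open>t2 - t1\<close> steps.\<close>

lemma periodic_imp_language:
  assumes k: "blocking k z0" and W: "W > 0" "translate W x = x" and b: "agree k z0 (translate c x)"
    and t: "t1 < t2" "(f ^^ t1) x = (f ^^ t2) x" and w: "(f ^^ t1) x \<in> cylinder w"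
  shows "w \<in> language (generic_limit_set f)"
proof (rule ccontr)
  assume "w \<notin> language (generic_limit_set f)"
  then have "cylinder w \<inter> generic_limit_set f = {}" by (simp add: language_def)
  with closedin_cylinder have "comeager_in full_shift (finitely_often f (cylinder w))"
    by (rule comeager_finitely_often)
  \<comment> \<open>Moving the block by \<open>j\<close> periods either way puts its centre left of
    0 and right of \<open>w\<close>.\<close>
  define j where "j = \<bar>c\<bar> + int (length w)"
  have j: "j \<le> j * W" "j \<ge> 0" unfolding j_def using W(1) by (auto simp: mult_le_cancel_left1)
  define c1 where "c1 = c - j * W"
  define c2 where "c2 = c + j * W"
  have c: "c1 \<le> 0" "c2 \<ge> int (length w)" "c1 \<le> c2" using j unfolding c1_def c2_def j_def by auto
  have "translate c1 x = translate c x" "translate c2 x = translate c x"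
    using translate_periodic[OF W(2), of j] translate_periodic[OF W(2), of "-j"]
    unfolding c1_def c2_def translate_def fun_eq_iff
    by (auto simp: algebra_simps) (metis add.assoc add.commute)+
  with b have b': "agree k z0 (translate c1 x)" "agree k z0 (translate c2 x)" by auto
  \<comment> \<open>Large enough for the window to contain \<open>[c1 - k, c2 + k]\<close>.\<close>
  define n where "n = nat (\<bar>c1\<bar> + \<bar>c2\<bar>) + k"
  obtain y where y: "y \<in> finitely_often f (cylinder w)" "agree n x y"
    using comeager_full_shift_meets[OF \<open>comeager_in _ _\<close>] by metis
  have "(f ^^ t) x i = (f ^^ t) y i" if "i \<ge> 0" "i \<le> int (length w)" for t i
    by (rule blocked_window[OF k c(3) b']) (use y(2) c that in \<open>auto simp: agree_def n_def\<close>)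
  then have cyl: "(f ^^ t) x \<in> cylinder w \<longleftrightarrow> (f ^^ t) y \<in> cylinder w" for t
    unfolding cylinder_def by auto
  have "(f ^^ (t1 + m * (t2 - t1))) x = (f ^^ t1) x" for m
  proof (induction m)
    case (Suc m)
    have "t1 + Suc m * (t2 - t1) = (t2 - t1) + (t1 + m * (t2 - t1))" by simp
    then have "(f ^^ (t1 + Suc m * (t2 - t1))) x = (f ^^ (t2 - t1)) ((f ^^ t1) x)"
      by (metis funpow_add comp_apply Suc)
    also have "\<dots> = (f ^^ t1) x" using t by (metis funpow_add comp_apply le_add_diff_inverse2 order_less_imp_le)
    finally show ?case .
  qed simp
  with w cyl have "(f ^^ (t1 + m * (t2 - t1))) y \<in> cylinder w" for m by metis
  then have "range (\<lambda>m. t1 + m * (t2 - t1)) \<subseteq> {t. (f ^^ t) y \<in> cylinder w}" by auto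
  with y(1) have "finite (range (\<lambda>m. t1 + m * (t2 - t1)))"
    unfolding finitely_often_def using finite_subset by blast
  moreover have "inj (\<lambda>m. t1 + m * (t2 - t1))" using t(1) by (auto simp: inj_def)
  ultimately show False using finite_imageD infinite_UNIV_nat by blast
qed

lemma block_dense:
  fixes z0 :: "int \<Rightarrow> 'a"
  shows "comeager_in full_shift
    {x. \<exists>c1\<le>0. \<exists>c2\<ge>l. agree k z0 (translate c1 x) \<and> agree k z0 (translate c2 x)}"
    (is "comeager_in _ ?D")
proof (rule comeager_in_dense_open)
  show "openin full_shift ?D"
    unfolding openin_full_shift
  proof
    fix x assume "x \<in> ?D"
    then obtain c1 c2 where c: "c1 \<le> 0" "c2 \<ge> l" "agree k z0 (translate c1 x)" "agree k z0 (translate c2 x)"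
      by blast
    define n where "n = k + nat (\<bar>c1\<bar> + \<bar>c2\<bar>)"
    have "y \<in> ?D" if "agree n x y" for y
    proof -
      have "agree k (translate c1 x) (translate c1 y)" "agree k (translate c2 x) (translate c2 y)"
        using that by (auto simp: agree_def translate_def n_def)
      with c show ?thesis using agree_trans by blast
    qed
    then show "\<exists>n. \<forall>y. agree n x y \<longrightarrow> y \<in> ?D" by blast
  qed
  show "full_shift closure_of ?D = topspace full_shift"
    unfolding dense_intersects_open
  proof (intro allI impI, elim conjE)
    fix U :: "(int \<Rightarrow> 'a) set" assume "openin full_shift U" "U \<noteq> {}"
    then obtain x n where n: "\<And>y. agree n x y \<Longrightarrow> y \<in> U"
      unfolding openin_full_shift by blast
    \<comment> \<open>The copies of the block centred at \<open>- c\<close> and \<open>c\<close>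
      stay clear of the prescribed window \<open>[-n, n]\<close>.\<close>
    define c where "c = int n + int k + 1 + \<bar>l\<bar>"
    define y where "y = (\<lambda>i. if \<bar>i\<bar> \<le> int n then x i else if i < 0 then z0 (i + c) else z0 (i - c))"
    have "agree n x y" by (auto simp: y_def agree_def)
    moreover have "agree k z0 (translate (- c) y)" "agree k z0 (translate c y)"
      by (auto simp: agree_def translate_def y_def c_def)
    moreover have "- c \<le> 0" "c \<ge> l" by (auto simp: c_def)
    ultimately show "?D \<inter> U \<noteq> {}" using n by blast
  qed
qed

lemma finite_periodic:
  assumes "W > 0"
  shows "finite {x :: int \<Rightarrow> 'a. translate W x = x}"
proof (rule inj_on_finite)
  show "inj_on (\<lambda>x. restrict x {0..<W}) {x :: int \<Rightarrow> 'a. translate W x = x}"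
  proof (rule inj_onI, simp only: mem_Collect_eq, rule ext)
    fix x y :: "int \<Rightarrow> 'a" and i
    assume x: "translate W x = x" and y: "translate W y = y" and eq: "restrict x {0..<W} = restrict y {0..<W}"
    have m: "z i = z (i mod W)" if "translate W z = z" for z :: "int \<Rightarrow> 'a"
      using translate_periodic[OF that, of "i div W"] unfolding translate_def
      by (metis mod_mult_div_eq mult.commute)
    have "i mod W \<in> {0..<W}" using assms by auto
    then have "x (i mod W) = y (i mod W)" using eq by (metis restrict_apply')
    with m[OF x] m[OF y] show "x i = y i" by simp
  qed
  show "(\<lambda>x. restrict x {0..<W}) ` {x :: int \<Rightarrow> 'a. translate W x = x} \<subseteq> ({0..<W} \<rightarrow>\<^sub>E UNIV)"
    by auto
  show "finite ({0..<W} \<rightarrow>\<^sub>E (UNIV :: 'a set))" by (rule finite_PiE) auto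
qed

text \<open>As \<open>w\<close> occurs in the generic limit set, some point with blocks on both
  sides of \<open>w\<close> visits its cylinder infinitely often. Repeating the segment between the
  blocks keeps these visits, and a finite set of periodic configurations forces a repetition among
  them.\<close>

lemma language_imp_periodic:
  assumes k: "blocking k z0" and w: "w \<in> language (generic_limit_set f)"
  obtains W x c t1 t2 where "W > 0" "translate W x = x" "agree k z0 (translate c x)"
    "t1 < t2" "(f ^^ t1) x = (f ^^ t2) x" "(f ^^ t1) x \<in> cylinder w"
proof -
  let ?D = "{x. \<exists>c1\<le>0. \<exists>c2\<ge>int (length w). agree k z0 (translate c1 x) \<and> agree k z0 (translate c2 x)}"
  have "\<not> comeager_in full_shift (finitely_often f (cylinder w))"
    using generic_limit_set_disjoint[OF openin_cylinder] w by (auto simp: language_def)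
  then have "\<not> ?D \<subseteq> finitely_often f (cylinder w)"
    using block_dense comeager_in_mono by blast
  then obtain x c1 c2 where x: "x \<notin> finitely_often f (cylinder w)"
    and c: "c1 \<le> 0" "c2 \<ge> int (length w)"
    and b: "agree k z0 (translate c1 x)" "agree k z0 (translate c2 x)" by blast
  \<comment> \<open>The length of the segment \<open>[c1 - k, c2 + k]\<close>, both blocks
    included.\<close>
  define W where "W = c2 - c1 + 2 * int k + 1"
  have W: "W > 0" using c by (simp add: W_def)
  define left where "left = c1 - int k"
  define y where "y = (\<lambda>i. x (left + (i - left) mod W))"
  have "(i + W - left) mod W = (i - left) mod W" for i
    by (metis add_diff_eq diff_add_eq mod_add_self2)
  then have yW: "translate W y = y" by (simp add: y_def translate_def)
  have xy: "x i = y i" if "c1 - int k \<le> i" "i \<le> c2 + int k" for i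
    using that by (simp add: y_def left_def W_def)
  have "(f ^^ t) x i = (f ^^ t) y i" if "i \<ge> 0" "i \<le> int (length w)" for t i
    by (rule blocked_window[OF k _ b xy]) (use c that in auto)
  then have cyl: "(f ^^ t) x \<in> cylinder w \<longleftrightarrow> (f ^^ t) y \<in> cylinder w" for t
    unfolding cylinder_def by auto
  let ?T = "{t. (f ^^ t) y \<in> cylinder w}"
  have inf: "infinite ?T" using x by (simp add: finitely_often_def cyl)
  have "(\<lambda>t. (f ^^ t) y) ` ?T \<subseteq> {x. translate W x = x}"
    using yW funpow_translate[of _ W y] by auto
  then have "finite ((\<lambda>t. (f ^^ t) y) ` ?T)" using finite_periodic[OF W] finite_subset by blast
  with inf have "\<not> inj_on (\<lambda>t. (f ^^ t) y) ?T" using finite_imageD by blast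
  then obtain t1 t2 where t: "t1 \<in> ?T" "t2 \<in> ?T" "t1 < t2" "(f ^^ t1) y = (f ^^ t2) y"
    unfolding inj_on_def by (metis nat_neq_iff)
  have "agree k (translate c1 x) (translate c1 y)"
    using xy c by (auto simp: agree_def translate_def)
  with b(1) have "agree k z0 (translate c1 y)" by (rule agree_trans)
  with that[OF W yW _ t(3,4)] t(1) show thesis by blast
qed

end

section \<open>Certificates\<close>

text \<open>Four header entries precede the diagram, which is stored row by row; columns are read
  cyclically.\<close>

definition cell :: "nat \<Rightarrow> nat \<Rightarrow> nat \<Rightarrow> nat" where
  "cell n t i = code_nth n (4 + (t * Suc (code_nth n 0) + i mod Suc (code_nth n 0)))"

text \<open>Pairs of time and column: the new cell, then its neighbourhood from left to right.
  Columns count from the left end of the neighbourhood, hence the new cell has column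
  \<open>R\<close>.\<close>

definition offsets :: "nat \<Rightarrow> (nat \<times> nat) list" where
  "offsets R = (1, R) # map (\<lambda>l. (0, l)) [0..<2 * R + 1]"

text \<open>A certificate \<open>n\<close> encodes a list \<open>[W - 1, t1, t2, i0]\<close> followed by the rows of a space-time
  diagram on a cycle of length \<open>W\<close>. Storing \<open>W - 1\<close> makes the modulus positive for every \<open>n\<close>.\<close>

definition certificate :: "nat list set \<Rightarrow> nat list \<Rightarrow> nat \<Rightarrow> nat \<Rightarrow> nat \<Rightarrow> bool" where
  "certificate S b R n v \<longleftrightarrow>
     code_nth n 1 < code_nth n 2 \<and>
     (\<forall>j<length b. cell n 0 j = code_nth (list_encode b) j) \<and>
     (\<forall>t<code_nth n 2. \<forall>i<Suc (code_nth n 0).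
        map (\<lambda>p. cell n (t + fst p) (i + snd p)) (offsets R) \<in> S) \<and>
     (\<forall>i<Suc (code_nth n 0). cell n (code_nth n 1) i = cell n (code_nth n 2) i) \<and>
     (\<forall>j<v. code_drop j v \<noteq> 0 \<longrightarrow> code_nth v j = cell n (code_nth n 1) (code_nth n 3 + j))"

text \<open>Under one or two bounded quantifiers the inputs appear behind as many
  \<open>tl\<close>.\<close>

lemma computable_var_tl:
  "Suc i < n \<Longrightarrow> computable n (\<lambda>xs. var i (tl xs))"
  "Suc (Suc i) < n \<Longrightarrow> computable n (\<lambda>xs. var i (tl (tl xs)))"
  by (simp_all add: computable_var)

lemma computable_cell:
  assumes "computable n F" "computable n G" "computable n H"
  shows "computable n (\<lambda>xs. cell (F xs) (G xs) (H xs))"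
  unfolding cell_def
  by (intro computable_code_nth computable_add computable_mult computable_mod computable_Suc
      computable_const assms) simp

lemma decidable_certificate:
  assumes "finite S"
  shows "decidable 2 (\<lambda>ys. certificate S b R (var 0 ys) (var 1 ys))"
  unfolding certificate_def
  by (intro decidable_conj decidable_less decidable_bounded_all decidable_map_in decidable_eq
      decidable_imp decidable_not computable_code_nth computable_code_drop computable_cell
      computable_Suc computable_var computable_var_tl computable_const computable_add assms) simp_all

section \<open>Soundness and completeness of certificates\<close>

context ca
begin

text \<open>The graph of the local rule, listed in the order of \<open>offsets\<close>.\<close>

definition rule_table :: "('a \<Rightarrow> nat) \<Rightarrow> nat list set" where
  "rule_table e = range (\<lambda>x. e (f x 0) # map (\<lambda>l. e (x (int l - int R))) [0..<2 * R + 1])"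

definition block_word :: "('a \<Rightarrow> nat) \<Rightarrow> nat \<Rightarrow> (int \<Rightarrow> 'a) \<Rightarrow> nat list" where
  "block_word e k z0 = map (\<lambda>j. e (z0 (int j - int k))) [0..<2 * k + 1]"

lemma finite_rule_table: "finite (rule_table e)"
proof (rule finite_subset)
  show "rule_table e \<subseteq> {xs. set xs \<subseteq> range e \<and> length xs = 2 * R + 2}"
    by (auto simp: rule_table_def simp del: upt_Suc)
qed (simp add: finite_lists_length_eq)

lemma map_offsets_in_rule_table:
  "map (\<lambda>p. g (fst p) (snd p)) (offsets R) \<in> rule_table e \<longleftrightarrow>
     (\<exists>x. g 1 R = e (f x 0) \<and> (\<forall>l<2 * R + 1. g 0 l = e (x (int l - int R))))"
  unfolding rule_table_def offsets_def by (auto simp: comp_def simp del: upt_Suc)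

text \<open>The table check makes the decoded rows an actual orbit of a spatially periodic
  configuration, to which \<open>periodic_imp_language\<close> applies.\<close>

lemma certificate_imp_language:
  assumes e: "inj e" and k: "blocking k z0"
    and cert: "certificate (rule_table e) (block_word e k z0) R n v"
  shows "v \<in> (\<lambda>w. list_encode (map e w)) ` language (generic_limit_set f)"
proof -
  define W where "W = Suc (code_nth n 0)"
  define t1 where "t1 = code_nth n 1"
  define t2 where "t2 = code_nth n 2"
  define i0 where "i0 = code_nth n 3"
  define d where "d = inv e"
  have d: "d (e a) = a" for a using e by (simp add: d_def)
  have c: "t1 < t2" "\<And>j. j < 2 * k + 1 \<Longrightarrow> cell n 0 j = e (z0 (int j - int k))"
    "\<And>t i. t < t2 \<Longrightarrow> i < W \<Longrightarrow> \<exists>x. cell n (Suc t) (i + R) = e (f x 0) \<and>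
        (\<forall>l<2 * R + 1. cell n t (i + l) = e (x (int l - int R)))"
    "\<And>i. i < W \<Longrightarrow> cell n t1 i = cell n t2 i"
    "\<And>j. j < v \<Longrightarrow> code_drop j v \<noteq> 0 \<Longrightarrow> code_nth v j = cell n t1 (i0 + j)"
    using cert map_offsets_in_rule_table[where g = "\<lambda>a b. cell n (_ + a) (_ + b)"]
    by (auto simp: certificate_def block_word_def code_nth_list_encode W_def t1_def t2_def i0_def
        simp del: upt_Suc)
  have W: "W > 0" by (simp add: W_def)
  have cell_mod: "cell n t (i mod W) = cell n t i" for t i by (simp add: cell_def W_def)
  \<comment> \<open>Every cell below row \<open>t2\<close> is the left end of some checked
    neighbourhood, hence codes a letter. This makes \<open>v\<close> the code of a genuine
    word.\<close>
  have range: "cell n t i \<in> range e" if "t < t2" for t i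
    using c(3)[OF that, of "i mod W"] W cell_mod[of t i]
    by (metis add.right_neutral mod_less_divisor rangeI add_gr_0 zero_less_one)
  define row where "row t = (\<lambda>i::int. d (cell n t (nat (i mod int W))))" for t
  have row_mod: "row t i = row t j" if "i mod int W = j mod int W" for t i j
    using that by (simp add: row_def)
  have row_int: "row t (int i) = d (cell n t i)" for t i
    using cell_mod by (simp add: row_def nat_mod_distrib)
  have step: "f (row t) = row (Suc t)" if t: "t < t2" for t
  proof
    fix p
    \<comment> \<open>The left end of the neighbourhood of \<open>p\<close>, reduced to a column of
      the cycle; \<open>p\<close> itself corresponds to \<open>i + R\<close>.\<close>
    define i where "i = nat ((p - int R) mod int W)"
    have i: "i < W" "int i = (p - int R) mod int W" using W by (auto simp: i_def nat_less_iff)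
    have i': "int (i + l) mod int W = (p - int R + int l) mod int W" for l
      using i(2) by (simp add: mod_add_left_eq)
    obtain x where x: "cell n (Suc t) (i + R) = e (f x 0)"
      "\<And>l. l < 2 * R + 1 \<Longrightarrow> cell n t (i + l) = e (x (int l - int R))"
      using c(3)[OF t i(1)] by blast
    have "agree R x (translate p (row t))"
      unfolding agree_def
    proof (intro allI impI)
      fix q :: int assume q: "\<bar>q\<bar> \<le> int R"
      define l where "l = nat (q + int R)"
      have l: "l < 2 * R + 1" "int l = q + int R" using q by (auto simp: l_def)
      have "x q = row t (int (i + l))" unfolding row_int using x(2)[OF l(1)] l(2) d by simp
      also have "\<dots> = row t (p + q)" by (rule row_mod) (use i'[of l] l(2) in simp)
      finally show "x q = translate p (row t) q" by (simp add: translate_def add.commute)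
    qed
    then have "f x 0 = f (translate p (row t)) 0" by (rule radius)
    also have "\<dots> = f (row t) p" by (simp add: f_translate) (simp add: translate_def)
    finally have "f (row t) p = f x 0" ..
    also have "\<dots> = row (Suc t) (int (i + R))" unfolding row_int using x(1) d by simp
    also have "\<dots> = row (Suc t) p" by (rule row_mod) (use i'[of R] in simp)
    finally show "f (row t) p = row (Suc t) p" .
  qed
  have rows: "(f ^^ t) (row 0) = row t" if "t \<le> t2" for t
    using that by (induction t) (auto simp: step)
  have "row t1 = row t2"
    unfolding row_def using c(4) W by (auto simp: fun_eq_iff nat_less_iff)
  \<comment> \<open>Moves the position \<open>i0\<close> of the word to the origin.\<close>
  define x where "x = translate (int i0) (row 0)"
  have fx: "(f ^^ t) x = translate (int i0) (row t)" if "t \<le> t2" for t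
    using rows[OF that] by (simp add: x_def funpow_translate)
  define w where "w = map d (list_decode v)"
  have v: "code_nth v j = list_decode v ! j" "list_decode v ! j = cell n t1 (i0 + j)"
    if "j < length (list_decode v)" for j
  proof -
    show 1: "code_nth v j = list_decode v ! j" using code_nth_list_encode[OF that] by simp
    have "j < v" using that length_le_list_encode[of "list_decode v"] by simp
    moreover have "code_drop j v \<noteq> 0"
      using that code_drop_list_encode_eq_0[of j "list_decode v"] by simp
    ultimately show "list_decode v ! j = cell n t1 (i0 + j)" using c(5) 1 by metis
  qed
  have "w \<in> language (generic_limit_set f)"
  proof (rule periodic_imp_language[OF k])
    show "int W > 0" using W by simp
    show "translate (int W) x = x"
    proof -
      have "(p + int W + int i0) mod int W = (p + int i0) mod int W" for p
        by (metis add.assoc add.commute mod_add_self2)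
      then show ?thesis unfolding x_def translate_def fun_eq_iff by (auto intro!: row_mod)
    qed
    \<comment> \<open>The block occupies columns 0 to \<open>2 * k\<close> of row 0, so its centre
      is \<open>k\<close>.\<close>
    show "agree k z0 (translate (int k - int i0) x)"
      unfolding agree_def
    proof (intro allI impI)
      fix q :: int assume q: "\<bar>q\<bar> \<le> int k"
      define j where "j = nat (q + int k)"
      have j: "j < 2 * k + 1" "int j = q + int k" using q by (auto simp: j_def)
      have "row 0 (int j) = z0 q" unfolding row_int using c(2)[OF j(1)] j(2) d by simp
      then show "z0 q = translate (int k - int i0) x q" by (simp add: x_def translate_def j(2))
    qed
    show "t1 < t2" by fact
    then show "(f ^^ t1) x = (f ^^ t2) x" using fx \<open>row t1 = row t2\<close> by simp
    have "row t1 (int (i0 + j)) = w ! j" if "j < length w" for j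
      unfolding row_int using v(2)[of j] that by (simp add: w_def)
    then show "(f ^^ t1) x \<in> cylinder w"
      using fx \<open>t1 < t2\<close> by (simp add: cylinder_def translate_def add.commute)
  qed
  moreover have "map e w = list_decode v"
  proof (rule nth_equalityI)
    fix j assume "j < length (map e w)"
    then have j: "j < length (list_decode v)" by (simp add: w_def)
    have "list_decode v ! j \<in> range e" using v(2)[OF j] range[OF c(1)] by simp
    with j show "map e w ! j = list_decode v ! j" by (simp add: w_def d_def f_inv_into_f)
  qed (simp add: w_def)
  ultimately show ?thesis by (metis image_eqI list_decode_inverse)
qed

text \<open>The certificate is the diagram of the configuration from
  \<open>language_imp_periodic\<close>, translated so that the block starts at column 0.\<close>

lemma language_imp_certificate:
  assumes k: "blocking k z0" and w: "w \<in> language (generic_limit_set f)"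
  shows "\<exists>n. certificate (rule_table e) (block_word e k z0) R n (list_encode (map e w))"
proof -
  obtain W' x c t1 t2 where W': "W' > 0" "translate W' x = x" and b: "agree k z0 (translate c x)"
    and t: "t1 < t2" "(f ^^ t1) x = (f ^^ t2) x" and cyl: "(f ^^ t1) x \<in> cylinder w"
    using language_imp_periodic[OF k w] .
  define W where "W = nat W'"
  have W: "W > 0" "W' = int W" using W'(1) by (auto simp: W_def)
  define y where "y = translate (c - int k) x"
  have fy: "(f ^^ t) y = translate (c - int k) ((f ^^ t) x)" for t by (simp add: y_def funpow_translate)
  have per: "(f ^^ t) x (i + j * int W) = (f ^^ t) x i" for t i j
  proof -
    have "translate (int W) ((f ^^ t) x) = (f ^^ t) x"
      using W' W(2) by (simp flip: funpow_translate)
    from translate_periodic[OF this, of j] show ?thesis unfolding translate_def by metis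
  qed
  have mod: "(f ^^ t) y (int (i mod W)) = (f ^^ t) y (int i)" for t i
  proof -
    have "int i = int (i mod W) + int (i div W) * int W"
      by (metis add.commute div_mult_mod_eq of_nat_add of_nat_mult)
    then have "int i + (c - int k) = int (i mod W) + (c - int k) + int (i div W) * int W" by simp
    then show ?thesis unfolding fy translate_def using per by metis
  qed
  \<comment> \<open>The origin of \<open>x\<close> is position \<open>k - c\<close> of
    \<open>y\<close>; the remainder turns it into a column.\<close>
  define i0 where "i0 = nat ((int k - c) mod int W)"
  obtain j0 where j0: "int i0 + (c - int k) = j0 * int W"
  proof -
    have "int i0 = (int k - c) mod int W" using W by (simp add: i0_def)
    also have "\<dots> = (int k - c) - (int k - c) div int W * int W" by (simp add: minus_div_mult_eq_mod)
    finally have "int i0 + (c - int k) = (- ((int k - c) div int W)) * int W" by simp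
    then show thesis by (rule that)
  qed
  \<comment> \<open>Rows 0 to \<open>t2\<close> inclusive, since row \<open>t2\<close> is compared
    with row \<open>t1\<close>.\<close>
  define tab where "tab = map (\<lambda>m. e ((f ^^ (m div W)) y (int (m mod W)))) [0..<Suc t2 * W]"
  define n where "n = list_encode ([W - 1, t1, t2, i0] @ tab)"
  have head: "code_nth n 0 = W - 1" "code_nth n 1 = t1" "code_nth n (Suc 0) = t1" "code_nth n 2 = t2"
    "code_nth n 3 = i0"
    by (simp_all add: n_def code_nth_list_encode del: list_encode.simps)
  have SW: "Suc (W - 1) = W" using W(1) by simp
  have cell: "cell n t i = e ((f ^^ t) y (int i))" if "t \<le> t2" for t i
  proof -
    have "t * W + i mod W < Suc t * W" using W(1) by simp
    also have "\<dots> \<le> Suc t2 * W" using that by (intro mult_le_mono1) simp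
    finally have lt: "t * W + i mod W < Suc t2 * W" .
    then have "4 + (t * W + i mod W) < length ([W - 1, t1, t2, i0] @ tab)" by (simp add: tab_def)
    then have "cell n t i = ([W - 1, t1, t2, i0] @ tab) ! (4 + (t * W + i mod W))"
      unfolding cell_def head SW unfolding n_def by (rule code_nth_list_encode)
    also have "\<dots> = tab ! (t * W + i mod W)" by (simp add: nth_append)
    also have "\<dots> = e ((f ^^ t) y (int (i mod W)))"
      using lt W(1) by (simp add: tab_def del: upt_Suc mult_Suc)
    finally show ?thesis by (simp add: mod)
  qed
  have "certificate (rule_table e) (block_word e k z0) R n (list_encode (map e w))"
    unfolding certificate_def head SW
  proof (intro conjI allI impI)
    show "t1 < t2" by fact
  next
    fix j assume j: "j < length (block_word e k z0)"
    have "z0 (int j - int k) = y (int j)"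
      using b j by (auto simp: agree_def y_def translate_def block_word_def algebra_simps)
    then show "cell n 0 j = code_nth (list_encode (block_word e k z0)) j"
      using j by (simp add: cell code_nth_list_encode) (simp add: block_word_def del: upt_Suc)
  next
    fix t' i assume "t' < t2" "i < W"
    have "f (translate (int (i + R)) ((f ^^ t') y)) 0 = (f ^^ Suc t') y (int (i + R))"
      unfolding f_translate by (simp add: translate_def)
    with \<open>t' < t2\<close> show "map (\<lambda>p. cell n (t' + fst p) (i + snd p)) (offsets R) \<in> rule_table e"
      unfolding map_offsets_in_rule_table[where g = "\<lambda>a b. cell n (t' + a) (i + b)"]
      by (intro exI[of _ "translate (int (i + R)) ((f ^^ t') y)"])
         (auto simp: cell translate_def add.commute)
  next
    fix i show "cell n t1 i = cell n t2 i" using t by (simp add: cell fy)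
  next
    fix j assume "code_drop j (list_encode (map e w)) \<noteq> 0"
    then have j: "j < length w" by (simp add: code_drop_list_encode_eq_0)
    have "(f ^^ t1) y (int (i0 + j)) = (f ^^ t1) x (int j + j0 * int W)"
      unfolding fy translate_def j0[symmetric] by (simp add: algebra_simps)
    also have "\<dots> = w ! j" using cyl j by (simp add: per cylinder_def)
    finally show "code_nth (list_encode (map e w)) j = cell n t1 (i0 + j)"
      using j t(1) by (simp add: code_nth_list_encode cell)
  qed
  then show ?thesis ..
qed

end

theorem proposition2:
  fixes f :: "(int \<Rightarrow> 'a::finite) \<Rightarrow> (int \<Rightarrow> 'a)"
  assumes "cellular_automaton f"
    and "equicontinuous_restriction f (generic_limit_set f)"
  shows "ce_language (language (generic_limit_set f))"
proof -
  obtain R where "ca f R" using cellular_automaton_imp_ca[OF assms(1)] .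
  then interpret ca f R .
  \<comment> \<open>The blocking word is hard-wired into the program as a constant; it need not be
    found from \<open>f\<close>.\<close>
  obtain k z0 where k: "blocking k z0" using blocking_exists[OF assms(2)] .
  show ?thesis
    unfolding ce_language_def
  proof (intro allI impI)
    fix e :: "'a \<Rightarrow> nat" assume "bij_betw e UNIV {..<CARD('a)}"
    then have e: "inj e" by (rule bij_betw_imp_inj_on)
    have "(\<lambda>w. list_encode (map e w)) ` language (generic_limit_set f) =
        {v. \<exists>n. certificate (rule_table e) (block_word e k z0) R n v}"
      using certificate_imp_language[OF e k] language_imp_certificate[OF k] by blast
    then show "ce_set ((\<lambda>w. list_encode (map e w)) ` language (generic_limit_set f))"
      using ce_set_Collect_Ex[OF decidable_certificate[OF finite_rule_table]] by simp
  qed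
qed

end
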